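(* Let $AX=B$, where all entries of $X\in\mathbb{R}^{n\times m}$ are nonzero, $A\in\mathbb{R}^{n\times n}$ is a nonsingular $\{1;1\}$-quasiseparable matrix with a quasiseparable representation $\Omega_{QS}$, and $B=\sum_{k=1}^M\omega^B_kS_k\in\mathbb{R}^{n\times m}$ has a sparse representation with parameter vector $\Omega_B=(\omega_1^B,\dots,\omega_M^B)$. Write $A=A_L+A_D+A_U$ with $A_L$ strictly lower triangular, $A_D$ diagonal and $A_U$ strictly upper triangular. Let $0\le f\in\mathbb{R}^M$ and $0\le\mathcal{E}_{QS}\in\mathbb{R}^{7n-8}$ be weight vectors, with $$\mathcal{E}_{QS}=\big(\{e_{p_i}\}_{i=2}^n,\{e_{a_i}\}_{i=2}^{n-1},\{e_{q_i}\}_{i=1}^{n-1},\{e_{g_i}\}_{i=1}^{n-1},\{e_{b_i}\}_{i=2}^{n-1},\{e_{h_i}\}_{i=2}^n,\{e_{d_i}\}_{i=1}^n\big),$$ and suppose $\Omega_{QS}\cap\Omega_B=\emptyset$ (the parameters of $A$ and $B$ are independent). Then $$\begin{aligned}\mathscr{K}_{\mathcal{E}_{QS},f}(A(\Omega_{QS}),B(\Omega_B))=\frac{1}{\|X\|_{\max}}\Big\|&\sum_{k=1}^M|A^{-1}S_k|f_k+|A^{-1}||\mathcal{D}_d||X|+|A^{-1}||\mathcal{D}_p||A_LX|+|A^{-1}A_L||\mathcal{D}_q||X|\\&+|A^{-1}||\mathcal{D}_g||A_UX|+|A^{-1}A_U||\mathcal{D}_h||X|\\&+\sum_{i=2}^{n-1}\left|A^{-1}\begin{bmatrix}0&0\\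 A(i+1:n,1:i-1)&0\end{bmatrix}X\right|\left|\frac{e_{a_i}}{a_i}\right|\\&+\sum_{i=2}^{n-1}\left|A^{-1}\begin{bmatrix}0&A(1:i-1,i+1:n)\\0&0\end{bmatrix}X\right|\left|\frac{e_{b_i}}{b_i}\right|\Big\|_{\max},\end{aligned}$$ where $\mathcal{D}_d=\mathrm{diag}(e_{d_1},\dots,e_{d_n})$, $\mathcal{D}_p=\mathrm{diag}\big(1,\frac{e_{p_2}}{p_2},\dots,\frac{e_{p_n}}{p_n}\big)$, $\mathcal{D}_q=\mathrm{diag}\big(\frac{e_{q_1}}{q_1},\dots,\frac{e_{q_{n-1}}}{q_{n-1}},1\big)$, $\mathcal{D}_g=\mathrm{diag}\big(\frac{e_{g_1}}{g_1},\dots,\frac{e_{g_{n-1}}}{g_{n-1}},1\big)$, $\mathcal{D}_h=\mathrm{diag}\big(1,\frac{e_{h_2}}{h_2},\dots,\frac{e_{h_n}}{h_n}\big)$.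
   Context: Let $n\ge2$. A quasiseparable representation of a $\{1;1\}$-quasiseparable matrix $A\in\mathbb{R}^{n\times n}$ is a vector of $7n-8$ real parameters $\Omega_{QS}=(\{p_i\}_{i=2}^n,\{a_i\}_{i=2}^{n-1},\{q_i\}_{i=1}^{n-1},\{d_i\}_{i=1}^n,\{g_i\}_{i=1}^{n-1},\{b_i\}_{i=2}^{n-1},\{h_i\}_{i=2}^n)$ with $A(i,i)=d_i$, $A(i,j)=p_ia_{i-1}a_{i-2}\cdots a_{j+1}q_j$ for $i>j$, and $A(i,j)=g_ib_{i+1}b_{i+2}\cdots b_{j-1}h_j$ for $i<j$ (empty products equal 1); $A$ is $\{1;1\}$-quasiseparable if and only if it has such a representation. Sparse representation of $B$: $B=\sum_{k=1}^M\omega_k^BS_k$, where the $S_k\in\mathbb{R}^{n\times m}$ are fixed constant matrices (typically with entries 0 and 1, describing the sparsity pattern) and $\Omega_B=(\omega^B_1,\dots,\omega^B_M)$ are independent real parameters, independent of those of $A$. Notation: $|Z|$ is the entrywise absolute value, $\|Z\|_{\max}=\max_{i,j}|z_{ij}|$, inequalities are entrywise. $A(i_1:i_2,j_1:j_2)$ is the submatrix with rows $i_1,\dots,i_2$ and columns $j_1,\dots,j_2$. The displayed block matrices are $n\times n$: $\begin{bmatrix}0&0\\ A(i+1:n,1:i-1)&0\end{bmatrix}$ agrees with $A$ in rows $i+1,\dots,n$ and columns $1,\dots,i-1$ and is zero elsewhere; $\begin{bmatrix}0&A(1:i-1,i+1:n)\\0&0\end{bmatrix}$ agrees with $A$ in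 rows $1,\dots,i-1$ and columns $i+1,\dots,n$ and is zero elsewhere. Convention for quotients: whenever the denominator parameter in a quotient such as $e_{p_i}/p_i$ is zero, the corresponding weight is required to be zero and the quotient is understood to be zero. Condition number: $$\mathscr{K}_{\mathcal{E}_{QS},f}(A(\Omega_{QS}),B(\Omega_B)):=\lim_{\eta\to0}\sup\left\{\frac1\eta\frac{\|\delta X\|_{\max}}{\|X\|_{\max}}: A(\Omega_{QS}+\delta\Omega_{QS})(X+\delta X)=B(\Omega_B+\delta\Omega_B),\ |\delta\Omega_{QS}|\le\eta\,\mathcal{E}_{QS},\ |\delta\Omega_B|\le\eta f\right\},$$ with $\eta>0$; $|\delta\Omega_{QS}|\le\eta\,\mathcal{E}_{QS}$ means that each parameter $\zeta$ is perturbed by at most $\eta e_\zeta$. *)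

theory Defs
  imports
    "HOL-Library.Extended_Real"
    "Jordan_Normal_Form.Gauss_Jordan_Elimination"
begin

text \<open>
  Matrices are those of \<^theory>\<open>Jordan_Normal_Form.Matrix\<close>, whose entries are indexed from 0.
  Parameters keep the usual indices starting from 1, so that the entry in row \<open>i\<close> and
  column \<open>j\<close> in the usual numbering is \<open>A $$ (i - 1, j - 1)\<close>.
\<close>


subsection \<open>Entrywise absolute value, maximum norm, inverse\<close>

definition mat_abs :: "real mat \<Rightarrow> real mat" where
  "mat_abs A = map_mat abs A"

text \<open>Meaningful for matrices with at least one row and one column only.\<close>

definition max_norm :: "real mat \<Rightarrow> real" where
  "max_norm A = Max (abs ` elements_mat A)"

text \<open>\<^const>\<open>mat_inverse\<close> returns \<^const>\<open>None\<close> exactly for the singular matrices.\<close>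

definition mat_inv :: "real mat \<Rightarrow> real mat" where
  "mat_inv A = the (mat_inverse A)"

text \<open>The type of matrices has no zero of its own (the dimensions are not part of the type),
  hence \<^const>\<open>sum\<close> is not available for matrices.\<close>

definition mat_sum :: "nat \<Rightarrow> nat \<Rightarrow> ('i \<Rightarrow> real mat) \<Rightarrow> 'i set \<Rightarrow> real mat" where
  "mat_sum n m F I = mat n m (\<lambda>(r, c). \<Sum>k\<in>I. F k $$ (r, c))"


subsection \<open>Parts of a square matrix\<close>

definition strict_lower_part :: "real mat \<Rightarrow> real mat" where
  "strict_lower_part A =
     mat (dim_row A) (dim_col A) (\<lambda>(r, c). if c < r then A $$ (r, c) else 0)"

definition diagonal_part :: "real mat \<Rightarrow> real mat" where
  "diagonal_part A =
     mat (dim_row A) (dim_col A) (\<lambda>(r, c). if r = c then A $$ (r, c) else 0)"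

definition strict_upper_part :: "real mat \<Rightarrow> real mat" where
  "strict_upper_part A =
     mat (dim_row A) (dim_col A) (\<lambda>(r, c). if r < c then A $$ (r, c) else 0)"

lemma lower_diagonal_upper:
  "A = strict_lower_part A + diagonal_part A + strict_upper_part A"
  by (rule eq_matI) (auto simp: strict_lower_part_def diagonal_part_def strict_upper_part_def)

text \<open>The block \<open>A(i+1:n, 1:i-1)\<close>, respectively \<open>A(1:i-1, i+1:n)\<close>, in its place in an
  \<open>n \<times> n\<close> matrix that vanishes elsewhere.\<close>

definition lower_block :: "nat \<Rightarrow> real mat \<Rightarrow> nat \<Rightarrow> real mat" where
  "lower_block n A i = mat n n (\<lambda>(r, c).
     if r + 1 \<in> {i+1..n} \<and> c + 1 \<in> {1..i-1} then A $$ (r, c) else 0)"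

definition upper_block :: "nat \<Rightarrow> real mat \<Rightarrow> nat \<Rightarrow> real mat" where
  "upper_block n A i = mat n n (\<lambda>(r, c).
     if r + 1 \<in> {1..i-1} \<and> c + 1 \<in> {i+1..n} then A $$ (r, c) else 0)"


subsection \<open>Quasiseparable representations\<close>

text \<open>
  A vector of \<open>7n - 8\<close> reals is a function on the names of the parameters, of which only the
  values on the finite set \<open>qs_index n\<close> matter. Parameters, weights and perturbations
  are all such vectors.
\<close>

datatype qs_param =
  Par_p nat | Par_a nat | Par_q nat | Par_d nat | Par_g nat | Par_b nat | Par_h nat

definition qs_index :: "nat \<Rightarrow> qs_param set" where
  "qs_index n =
     Par_p ` {2..n} \<union> Par_a ` {2..n-1} \<union> Par_q ` {1..n-1} \<union> Par_d ` {1..n} \<union>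
     Par_g ` {1..n-1} \<union> Par_b ` {2..n-1} \<union> Par_h ` {2..n}"

lemma card_qs_index:
  assumes "n \<ge> 2"
  shows "card (qs_index n) = 7 * n - 8"
proof -
  have "card (qs_index n) =
      card {2..n} + card {2..n-1} + card {1..n-1} + card {1..n} +
      card {1..n-1} + card {2..n-1} + card {2..n}"
    unfolding qs_index_def
    by (subst card_Un_disjoint; auto simp: card_image inj_on_def)+
  then show ?thesis using assms by simp
qed

definition qs_mat :: "nat \<Rightarrow> (qs_param \<Rightarrow> real) \<Rightarrow> real mat" where
  "qs_mat n \<Omega> = mat n n (\<lambda>(r, c). let i = r + 1; j = c + 1 in
     if i = j then \<Omega> (Par_d i)
     else if i > j then \<Omega> (Par_p i) * (\<Prod>k\<in>{j+1..i-1}. \<Omega> (Par_a k)) * \<Omega> (Par_q j)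
     else \<Omega> (Par_g i) * (\<Prod>k\<in>{i+1..j-1}. \<Omega> (Par_b k)) * \<Omega> (Par_h j))"

text \<open>
  The names of the parameters by which a weight gets divided; the diagonal parameters are not
  among them. Where such a parameter is zero the weight has to vanish, and
  the quotient is zero because \<open>x / 0 = 0\<close> in HOL.
\<close>

definition weights_admissible ::
    "nat \<Rightarrow> (qs_param \<Rightarrow> real) \<Rightarrow> (qs_param \<Rightarrow> real) \<Rightarrow> bool" where
  "weights_admissible n \<Omega> E \<longleftrightarrow>
     (\<forall>\<zeta>\<in>qs_index n - Par_d ` {1..n}. \<Omega> \<zeta> = 0 \<longrightarrow> E \<zeta> = 0)"


subsection \<open>Sparse representations\<close>

definition sparse_mat ::
    "nat \<Rightarrow> nat \<Rightarrow> nat \<Rightarrow> (nat \<Rightarrow> real mat) \<Rightarrow> (nat \<Rightarrow> real) \<Rightarrow> real mat" where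
  "sparse_mat n m M S \<omega> = mat_sum n m (\<lambda>k. \<omega> k \<cdot>\<^sub>m S k) {1..M}"


subsection \<open>Condition number\<close>

text \<open>
  The parameters of the matrix and of the right-hand side are perturbed independently of each
  other. The supremum is taken in the extended reals: for large \<open>\<eta>\<close> a perturbed
  matrix may be singular and the set of quotients unbounded.
\<close>

definition qs_relative_change ::
    "nat \<Rightarrow> nat \<Rightarrow> nat \<Rightarrow> (nat \<Rightarrow> real mat) \<Rightarrow> (qs_param \<Rightarrow> real) \<Rightarrow> (nat \<Rightarrow> real) \<Rightarrow>
     (qs_param \<Rightarrow> real) \<Rightarrow> (nat \<Rightarrow> real) \<Rightarrow> real mat \<Rightarrow> real \<Rightarrow> ereal" where
  "qs_relative_change n m M S \<Omega> \<omega> E f X \<eta> =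
     Sup {ereal (1 / \<eta> * (max_norm \<delta>X / max_norm X)) | \<delta>X \<delta>\<Omega> \<delta>\<omega>.
       \<delta>X \<in> carrier_mat n m \<and>
       qs_mat n (\<lambda>\<zeta>. \<Omega> \<zeta> + \<delta>\<Omega> \<zeta>) * (X + \<delta>X) = sparse_mat n m M S (\<lambda>k. \<omega> k + \<delta>\<omega> k) \<and>
       (\<forall>\<zeta>\<in>qs_index n. \<bar>\<delta>\<Omega> \<zeta>\<bar> \<le> \<eta> * E \<zeta>) \<and>
       (\<forall>k\<in>{1..M}. \<bar>\<delta>\<omega> k\<bar> \<le> \<eta> * f k)}"

text \<open>
  \<open>X\<close> is the solution of the unperturbed equation. \<^const>\<open>Lim\<close> is unspecified if
  there is no limit, so statements on the condition number should include that
  the limit exists.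
\<close>

definition qs_cond ::
    "nat \<Rightarrow> nat \<Rightarrow> nat \<Rightarrow> (nat \<Rightarrow> real mat) \<Rightarrow> (qs_param \<Rightarrow> real) \<Rightarrow> (nat \<Rightarrow> real) \<Rightarrow>
     (qs_param \<Rightarrow> real) \<Rightarrow> (nat \<Rightarrow> real) \<Rightarrow> real mat \<Rightarrow> ereal" where
  "qs_cond n m M S \<Omega> \<omega> E f X = Lim (at_right 0) (qs_relative_change n m M S \<Omega> \<omega> E f X)"


subsection \<open>Diagonal weight matrices\<close>

text \<open>In position \<open>i\<close> of \<^const>\<open>mat_diag\<close> stands the weight with index \<open>i + 1\<close>. The entries
  1 stand where there is no parameter.\<close>

definition D_d :: "nat \<Rightarrow> (qs_param \<Rightarrow> real) \<Rightarrow> real mat" where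
  "D_d n E = mat_diag n (\<lambda>i. E (Par_d (i+1)))"

definition D_p :: "nat \<Rightarrow> (qs_param \<Rightarrow> real) \<Rightarrow> (qs_param \<Rightarrow> real) \<Rightarrow> real mat" where
  "D_p n \<Omega> E = mat_diag n (\<lambda>i. if i + 1 = 1 then 1 else E (Par_p (i+1)) / \<Omega> (Par_p (i+1)))"

definition D_q :: "nat \<Rightarrow> (qs_param \<Rightarrow> real) \<Rightarrow> (qs_param \<Rightarrow> real) \<Rightarrow> real mat" where
  "D_q n \<Omega> E = mat_diag n (\<lambda>i. if i + 1 = n then 1 else E (Par_q (i+1)) / \<Omega> (Par_q (i+1)))"

definition D_g :: "nat \<Rightarrow> (qs_param \<Rightarrow> real) \<Rightarrow> (qs_param \<Rightarrow> real) \<Rightarrow> real mat" where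
  "D_g n \<Omega> E = mat_diag n (\<lambda>i. if i + 1 = n then 1 else E (Par_g (i+1)) / \<Omega> (Par_g (i+1)))"

definition D_h :: "nat \<Rightarrow> (qs_param \<Rightarrow> real) \<Rightarrow> (qs_param \<Rightarrow> real) \<Rightarrow> real mat" where
  "D_h n \<Omega> E = mat_diag n (\<lambda>i. if i + 1 = 1 then 1 else E (Par_h (i+1)) / \<Omega> (Par_h (i+1)))"

end

theory Submission
  imports Defs "Jordan_Normal_Form.Determinant"
begin

text \<open>
  Every entry of \<open>A(\<Omega>)\<close> is a product of distinct parameters (\<open>index_qs_mat\<close>). Expanding such a
  product gives \<open>A(\<Omega> + \<delta>) = A + \<Sum>\<zeta>. \<delta> \<zeta> D\<^sub>\<zeta> + O(\<eta>\<^sup>2)\<close>, uniformly over all perturbations with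
  \<open>\<bar>\<delta> \<zeta>\<bar> \<le> \<eta> E \<zeta>\<close>, where \<open>D\<^sub>\<zeta>\<close> is the partial derivative with respect to \<open>\<zeta>\<close>
  (\<open>qs_mat_first_order\<close>). For small \<open>\<eta>\<close> the perturbed matrix stays nonsingular, and a
  perturbation bound for linear systems (\<open>perturbed_solution_first_order\<close>) turns the expansion into
  \<open>\<delta>X = A\<^sup>-\<^sup>1 (\<delta>B - (\<Sum>\<zeta>. \<delta> \<zeta> D\<^sub>\<zeta>) X) + O(\<eta>\<^sup>2)\<close>,
  again uniformly (\<open>qs_perturbed_solution\<close>).

  In each entry the leading part is a linear form in independent variables that range over
  intervals. The maximum of its modulus is \<open>\<eta>\<close> times the weighted sum of the absolute values of
  its coefficients, and it is attained where the signs of the perturbations match those of the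
  coefficients. So the supremum in the condition number differs from the maximum norm of these
  sums (\<open>qs_sensitivity\<close>), divided by the norm of \<open>X\<close>, by \<open>O(\<eta>)\<close>, and the limit exists and
  has this value (\<open>qs_relative_change_tendsto\<close>).

  The stated formula is an evaluation of these sums. No entry of \<open>A\<close> contains a parameter twice,
  so \<open>\<Omega> \<zeta> D\<^sub>\<zeta>\<close> consists of the entries of \<open>A\<close> that contain \<open>\<zeta>\<close>: row \<open>i\<close> of the strictly lower
  part for \<open>p\<^sub>i\<close>, column \<open>j\<close> of it for \<open>q\<^sub>j\<close>, likewise with the strictly upper part for \<open>g\<^sub>i\<close> and
  \<open>h\<^sub>j\<close>, and an off-diagonal block for \<open>a\<^sub>i\<close> and \<open>b\<^sub>i\<close>. The weight of \<open>\<zeta>\<close> thereby becomes the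
  quotient \<open>E \<zeta> / \<Omega> \<zeta>\<close>; where \<open>\<Omega> \<zeta> = 0\<close>, admissibility makes the weight vanish together with
  the term. For \<open>d\<^sub>i\<close> the derivative is a matrix unit and no division occurs.
\<close>

section \<open>Entries and the maximum norm\<close>

lemma index_mult_mat_sum:
  assumes "P \<in> carrier_mat n k" "Q \<in> carrier_mat k m" "r < n" "c < m"
  shows "(P * Q) $$ (r, c) = (\<Sum>l<k. P $$ (r, l) * Q $$ (l, c))"
  using assms by (auto simp: scalar_prod_def lessThan_atLeast0)

lemma finite_elements_mat: "finite (elements_mat P)"
  by (simp add: elements_mat_def)

lemma abs_le_max_norm:
  assumes "P \<in> carrier_mat n m" "r < n" "c < m"
  shows "\<bar>P $$ (r, c)\<bar> \<le> max_norm P"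
  unfolding max_norm_def
  using assms by (intro Max_ge) (auto simp: finite_elements_mat)

lemma max_norm_attained:
  assumes "P \<in> carrier_mat n m" "0 < n" "0 < m"
  obtains r c where "r < n" "c < m" "max_norm P = \<bar>P $$ (r, c)\<bar>"
proof -
  have "P $$ (0, 0) \<in> elements_mat P"
    using assms by blast
  then have "max_norm P \<in> abs ` elements_mat P"
    unfolding max_norm_def by (intro Max_in) (auto simp: finite_elements_mat)
  then show thesis
    using assms that by fastforce
qed

lemma max_norm_le:
  assumes "P \<in> carrier_mat n m" "0 < n" "0 < m"
    and "\<And>r c. r < n \<Longrightarrow> c < m \<Longrightarrow> \<bar>P $$ (r, c)\<bar> \<le> b"
  shows "max_norm P \<le> b"
  by (rule max_norm_attained[OF assms(1-3)]) (simp add: assms(4))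

lemma max_norm_nonneg:
  assumes "P \<in> carrier_mat n m" "0 < n" "0 < m"
  shows "0 \<le> max_norm P"
  by (rule max_norm_attained[OF assms]) simp

lemma max_norm_minus_le:
  assumes "P \<in> carrier_mat n m" "Q \<in> carrier_mat n m" "0 < n" "0 < m"
  shows "max_norm (P - Q) \<le> max_norm P + max_norm Q"
proof (rule max_norm_le)
  show "P - Q \<in> carrier_mat n m" using assms by auto
  fix r c assume rc: "r < n" "c < m"
  have "\<bar>(P - Q) $$ (r, c)\<bar> \<le> \<bar>P $$ (r, c)\<bar> + \<bar>Q $$ (r, c)\<bar>"
    using assms rc by auto
  also have "\<dots> \<le> max_norm P + max_norm Q"
    using assms rc by (intro add_mono abs_le_max_norm)
  finally show "\<bar>(P - Q) $$ (r, c)\<bar> \<le> max_norm P + max_norm Q" .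
qed (use assms in auto)

lemma max_norm_mult_le:
  assumes "P \<in> carrier_mat n k" "Q \<in> carrier_mat k m" "0 < n" "0 < k" "0 < m"
  shows "max_norm (P * Q) \<le> real k * max_norm P * max_norm Q"
proof (rule max_norm_le)
  show "P * Q \<in> carrier_mat n m" using assms by auto
  fix r c assume rc: "r < n" "c < m"
  have "\<bar>(P * Q) $$ (r, c)\<bar> \<le> (\<Sum>l<k. \<bar>P $$ (r, l)\<bar> * \<bar>Q $$ (l, c)\<bar>)"
    unfolding index_mult_mat_sum[OF assms(1,2) rc]
    by (rule order.trans[OF sum_abs]) (simp add: abs_mult)
  also have "\<dots> \<le> (\<Sum>l<k. max_norm P * max_norm Q)"
    using assms rc
    by (intro sum_mono mult_mono abs_le_max_norm[of P n k] abs_le_max_norm[of Q k m]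
        max_norm_nonneg[of P n k]) auto
  finally show "\<bar>(P * Q) $$ (r, c)\<bar> \<le> real k * max_norm P * max_norm Q"
    by simp
qed (use assms in auto)

lemma max_norm_triangle:
  assumes "P \<in> carrier_mat n m" "Q \<in> carrier_mat n m" "0 < n" "0 < m"
  shows "max_norm P \<le> max_norm (P - Q) + max_norm Q"
proof (rule max_norm_le[OF assms(1,3,4)])
  fix r c assume rc: "r < n" "c < m"
  have "\<bar>P $$ (r, c)\<bar> \<le> \<bar>(P - Q) $$ (r, c)\<bar> + \<bar>Q $$ (r, c)\<bar>"
    using assms rc by simp
  also have "\<dots> \<le> max_norm (P - Q) + max_norm Q"
    using assms rc by (intro add_mono abs_le_max_norm[of _ n m] minus_carrier_mat)
  finally show "\<bar>P $$ (r, c)\<bar> \<le> max_norm (P - Q) + max_norm Q" .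
qed

section \<open>Perturbation of linear systems\<close>

lemma max_norm_eq_0D:
  assumes "P \<in> carrier_mat n m" "max_norm P \<le> 0" "0 < n" "0 < m"
  shows "P = 0\<^sub>m n m"
proof (rule eq_matI)
  fix r c assume "r < dim_row (0\<^sub>m n m :: real mat)" "c < dim_col (0\<^sub>m n m :: real mat)"
  then show "P $$ (r, c) = 0\<^sub>m n m $$ (r, c)"
    using abs_le_max_norm[OF assms(1), of r c] assms(2) by auto
qed (use assms in auto)

lemma mult_minus_cancel_mat:
  fixes A A' Y :: "real mat"
  assumes "A \<in> carrier_mat n n" "A' \<in> carrier_mat n n" "Y \<in> carrier_mat n m"
  shows "A' * Y - (A' - A) * Y = A * Y"
proof -
  have "P - (P - Q) = Q" if "P \<in> carrier_mat n m" "Q \<in> carrier_mat n m" for P Q :: "real mat"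
    using that by (intro eq_matI) auto
  moreover have "(A' - A) * Y = A' * Y - A * Y"
    by (rule minus_mult_distrib_mat[OF assms(2,1,3)])
  ultimately show ?thesis using assms by simp
qed

text \<open>
  From \<open>A Y = A' Y - (A' - A) Y\<close> one gets \<open>Y = V A' Y - V (A' - A) Y\<close>. The norm of the second
  term is at most half of the norm of \<open>Y\<close>, so it can be absorbed on the left. This bounds the
  solutions of a perturbed system before anything is known about their size.
\<close>

lemma perturbed_system_apriori:
  assumes carr: "V \<in> carrier_mat n n" "A \<in> carrier_mat n n" "A' \<in> carrier_mat n n"
      "Y \<in> carrier_mat n m"
    and pos: "0 < n" "0 < m" and VA: "V * A = 1\<^sub>m n"
    and small: "(real n)\<^sup>2 * max_norm V * max_norm (A' - A) \<le> 1 / 2"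
  shows "max_norm Y \<le> 2 * real n * max_norm V * max_norm (A' * Y)"
proof -
  have AA: "A' - A \<in> carrier_mat n n" using carr by auto
  have prods: "A' * Y \<in> carrier_mat n m" "(A' - A) * Y \<in> carrier_mat n m"
    "V * (A' * Y) \<in> carrier_mat n m" "V * ((A' - A) * Y) \<in> carrier_mat n m"
    using carr by auto
  have "V * (A' * Y - (A' - A) * Y) = V * (A * Y)"
    by (simp only: mult_minus_cancel_mat[OF carr(2-4)])
  also have "\<dots> = Y"
    using carr(4) by (simp add: assoc_mult_mat[OF carr(1,2,4), symmetric] VA)
  finally have "max_norm Y = max_norm (V * (A' * Y - (A' - A) * Y))"
    by (rule arg_cong[OF sym, where f = max_norm])
  also have "V * (A' * Y - (A' - A) * Y) = V * (A' * Y) - V * ((A' - A) * Y)"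
    by (rule mult_minus_distrib_mat[OF carr(1) prods(1,2)])
  also have "max_norm \<dots> \<le> max_norm (V * (A' * Y)) + max_norm (V * ((A' - A) * Y))"
    by (rule max_norm_minus_le[OF prods(3,4) pos])
  also have "\<dots> \<le> real n * max_norm V * max_norm (A' * Y)
      + real n * max_norm V * (real n * max_norm (A' - A) * max_norm Y)"
    using max_norm_nonneg[OF carr(1) pos(1,1)]
    by (intro add_mono order.trans[OF max_norm_mult_le[OF carr(1) prods(2) pos(1,1,2)]]
        mult_left_mono max_norm_mult_le[OF carr(1) prods(1) pos(1,1,2)]
        max_norm_mult_le[OF AA carr(4) pos(1,1,2)]) auto
  also have "\<dots> = real n * max_norm V * max_norm (A' * Y)
      + ((real n)\<^sup>2 * max_norm V * max_norm (A' - A)) * max_norm Y"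
    by (simp add: power2_eq_square)
  also have "\<dots> \<le> real n * max_norm V * max_norm (A' * Y) + 1 / 2 * max_norm Y"
    using max_norm_nonneg[OF carr(4) pos] by (intro add_left_mono mult_right_mono small)
  finally show ?thesis by simp
qed

text \<open>
  A vector in the kernel of \<open>A'\<close>, regarded as a matrix with one column, vanishes by the a priori
  bound; hence \<open>A'\<close> is nonsingular.
\<close>

lemma perturbed_system_solvable:
  assumes carr: "V \<in> carrier_mat n n" "A \<in> carrier_mat n n" "A' \<in> carrier_mat n n"
      "B' \<in> carrier_mat n m"
    and n: "0 < n" and VA: "V * A = 1\<^sub>m n"
    and small: "(real n)\<^sup>2 * max_norm V * max_norm (A' - A) \<le> 1 / 2"
  shows "\<exists>Y\<in>carrier_mat n m. A' * Y = B'"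
proof -
  have "det A' \<noteq> 0"
  proof
    assume "det A' = 0"
    then obtain v where v: "v \<in> carrier_vec n" "v \<noteq> 0\<^sub>v n" "A' *\<^sub>v v = 0\<^sub>v n"
      using det_0_iff_vec_prod_zero[OF carr(3)] by blast
    \<comment> \<open>The norm is defined on matrices, so the vector is turned into a column.\<close>
    define Z where "Z = mat n 1 (\<lambda>(i, j). v $ i)"
    have Z: "Z \<in> carrier_mat n 1" by (simp add: Z_def)
    have colZ: "col Z 0 = v"
      using v by (intro eq_vecI) (auto simp: Z_def)
    have "A' * Z = 0\<^sub>m n 1"
    proof (rule eq_matI)
      fix i j assume "i < dim_row (0\<^sub>m n 1 :: real mat)" "j < dim_col (0\<^sub>m n 1 :: real mat)"
      then have ij: "i < n" "j = 0" by auto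
      have "(A' *\<^sub>v v) $ i = 0" using v ij by simp
      then show "(A' * Z) $$ (i, j) = 0\<^sub>m n 1 $$ (i, j)"
        using ij carr Z by (simp add: colZ)
    qed (use carr Z in auto)
    moreover have "max_norm (0\<^sub>m n 1) = 0"
      by (rule max_norm_attained[of "0\<^sub>m n 1" n 1]) (use n in auto)
    ultimately have "max_norm Z \<le> 0"
      using perturbed_system_apriori[OF carr(1-3) Z n _ VA small] by simp
    then have "Z = 0\<^sub>m n 1"
      using max_norm_eq_0D[OF Z] n by simp
    then have "v = col (0\<^sub>m n 1) 0" using colZ by simp
    then show False using v by simp
  qed
  then obtain W where W: "W \<in> carrier_mat n n" "A' * W = 1\<^sub>m n"
    using det_non_zero_imp_unit[OF carr(3), of "()"]
    by (auto simp: Units_def ring_mat_def)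
  show ?thesis
  proof (rule bexI[of _ "W * B'"])
    show "A' * (W * B') = B'"
      using carr(4) by (simp add: assoc_mult_mat[OF carr(3) W(1) carr(4), symmetric] W(2))
  qed (use W carr in auto)
qed

text \<open>
  Here \<open>A\<^sub>1\<close> is the linear part of \<open>A' - A\<close>, and \<open>Y\<close> is the change of the solution \<open>X\<close>.
  With \<open>\<alpha>\<close> and \<open>\<beta>\<close> of order \<open>\<eta>\<close> and \<open>\<rho>\<close> of order \<open>\<eta>\<^sup>2\<close> the right-hand side is of order
  \<open>\<eta>\<^sup>2\<close>: the neglected terms are \<open>V (A' - A - A\<^sub>1) X\<close> and \<open>V (A' - A) Y\<close>, and \<open>Y\<close> itself is of
  order \<open>\<eta>\<close> by the a priori bound. The estimate is explicit in order to be uniform in the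
  perturbation.
\<close>

lemma perturbed_solution_first_order:
  assumes carr: "V \<in> carrier_mat n n" "A \<in> carrier_mat n n" "A' \<in> carrier_mat n n"
      "A\<^sub>1 \<in> carrier_mat n n" "B' \<in> carrier_mat n m" "X \<in> carrier_mat n m" "Y \<in> carrier_mat n m"
    and pos: "0 < n" "0 < m" and VA: "V * A = 1\<^sub>m n"
    and eq: "A' * (X + Y) = B'"
    and small: "(real n)\<^sup>2 * max_norm V * max_norm (A' - A) \<le> 1 / 2"
    and \<alpha>: "max_norm (A' - A) \<le> \<alpha>"
    and \<rho>: "max_norm (A' - A - A\<^sub>1) \<le> \<rho>"
    and \<beta>: "max_norm (B' - A * X) \<le> \<beta>"
  shows "max_norm (Y - V * (B' - A * X - A\<^sub>1 * X)) \<le>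
    real n * max_norm V * (real n * \<rho> * max_norm X +
      real n * \<alpha> * (2 * real n * max_norm V * (\<beta> + real n * \<alpha> * max_norm X)))"
proof -
  define \<nu> x where "\<nu> = max_norm V" and "x = max_norm X"
  have nn: "0 \<le> \<nu>" "0 \<le> x" "0 \<le> max_norm (A' - A)" "0 \<le> max_norm Y" "0 \<le> max_norm (A' - A - A\<^sub>1)"
    unfolding \<nu>_def x_def
    by (rule max_norm_nonneg[OF _ pos(1,1)] max_norm_nonneg[OF _ pos],
        simp add: carr minus_carrier_mat)+
  have \<alpha>0: "0 \<le> \<alpha>" using nn \<alpha> by linarith
  have split: "A' * Y = (B' - A * X) - (A' - A) * X"
  proof -
    have Q: "Q = P + Q - R - (P - R)"
      if "P \<in> carrier_mat n m" "Q \<in> carrier_mat n m" "R \<in> carrier_mat n m" for P Q R :: "real mat"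
      using that by (intro eq_matI) auto
    have "A' * Y = A' * X + A' * Y - A * X - (A' * X - A * X)"
      using carr by (intro Q) auto
    also have "A' * X + A' * Y = B'"
      unfolding eq[symmetric] by (rule mult_add_distrib_mat[OF carr(3,6,7), symmetric])
    also have "A' * X - A * X = (A' - A) * X"
      by (rule minus_mult_distrib_mat[OF carr(3,2,6), symmetric])
    finally show ?thesis .
  qed
  have "max_norm (A' * Y) \<le> max_norm (B' - A * X) + max_norm ((A' - A) * X)"
    unfolding split using carr pos by (intro max_norm_minus_le[of _ n m]) auto
  also have "\<dots> \<le> \<beta> + real n * \<alpha> * x"
    using carr pos nn \<alpha> unfolding x_def
    by (intro add_mono \<beta> order.trans[OF max_norm_mult_le[of _ n n _ m]] mult_mono) auto
  finally have res: "max_norm (A' * Y) \<le> \<beta> + real n * \<alpha> * x" .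
  have "max_norm Y \<le> 2 * real n * \<nu> * max_norm (A' * Y)"
    unfolding \<nu>_def by (rule perturbed_system_apriori[OF carr(1-3) carr(7) pos VA small])
  also have "\<dots> \<le> 2 * real n * \<nu> * (\<beta> + real n * \<alpha> * x)"
    using nn by (intro mult_left_mono res) auto
  finally have Y: "max_norm Y \<le> 2 * real n * \<nu> * (\<beta> + real n * \<alpha> * x)" .
  have AY: "A * Y = (B' - A * X) - (A' - A) * X - (A' - A) * Y"
    using mult_minus_cancel_mat[OF carr(2,3,7)] by (simp only: split)
  define R where "R = A' - A - A\<^sub>1"
  have R: "R \<in> carrier_mat n n" unfolding R_def using carr by (intro minus_carrier_mat)
  have Rsplit: "A' - A = R + A\<^sub>1"
    unfolding R_def using carr by (intro eq_matI) auto
  have eqR: "A * Y - (B' - A * X - A\<^sub>1 * X) = 0\<^sub>m n m - R * X - (A' - A) * Y"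
  proof -
    have P: "(P - (Q + T) - U) - (P - T) = 0\<^sub>m n m - Q - U"
      if "P \<in> carrier_mat n m" "Q \<in> carrier_mat n m" "T \<in> carrier_mat n m" "U \<in> carrier_mat n m"
      for P Q T U :: "real mat"
      using that by (intro eq_matI) auto
    have "(A' - A) * X = R * X + A\<^sub>1 * X"
      unfolding Rsplit by (rule add_mult_distrib_mat[OF R carr(4) carr(6)])
    then show ?thesis
      unfolding AY using carr R by (simp only:) (rule P, auto)
  qed
  have "Y - V * (B' - A * X - A\<^sub>1 * X) = V * (A * Y) - V * (B' - A * X - A\<^sub>1 * X)"
  proof -
    have "Y = V * (A * Y)"
      using carr(7) by (simp add: assoc_mult_mat[OF carr(1,2,7), symmetric] VA)
    then show ?thesis by (rule arg_cong[where f = "\<lambda>Z. Z - _"])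
  qed
  also have "\<dots> = V * (A * Y - (B' - A * X - A\<^sub>1 * X))"
    using carr by (intro mult_minus_distrib_mat[symmetric]) auto
  also have "\<dots> = V * (0\<^sub>m n m - R * X - (A' - A) * Y)"
    by (simp only: eqR)
  finally have "max_norm (Y - V * (B' - A * X - A\<^sub>1 * X))
      = max_norm (V * (0\<^sub>m n m - R * X - (A' - A) * Y))" by (rule arg_cong[where f = max_norm])
  also have "\<dots> \<le> real n * \<nu> * max_norm (0\<^sub>m n m - R * X - (A' - A) * Y)"
    unfolding \<nu>_def using carr pos R by (intro max_norm_mult_le[of _ n n _ m]) auto
  also have "max_norm (0\<^sub>m n m - R * X - (A' - A) * Y)
      \<le> max_norm (0\<^sub>m n m) + max_norm (R * X) + max_norm ((A' - A) * Y)"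
    using carr pos R
    by (intro order.trans[OF max_norm_minus_le[of _ n m]] add_right_mono max_norm_minus_le[of _ n m]) auto
  also have "max_norm (0\<^sub>m n m) = 0"
    by (rule max_norm_attained[of "0\<^sub>m n m" n m]) (use pos in auto)
  also have "0 + max_norm (R * X) + max_norm ((A' - A) * Y)
      \<le> real n * \<rho> * x + real n * \<alpha> * (2 * real n * \<nu> * (\<beta> + real n * \<alpha> * x))"
  proof -
    have "max_norm (R * X) \<le> real n * max_norm R * x"
      unfolding x_def using carr pos R by (intro max_norm_mult_le[of _ n n _ m]) auto
    also have "\<dots> \<le> real n * \<rho> * x"
      using \<rho> nn unfolding R_def by (intro mult_right_mono mult_left_mono) auto
    finally have 1: "max_norm (R * X) \<le> real n * \<rho> * x" .
    have "max_norm ((A' - A) * Y) \<le> real n * max_norm (A' - A) * max_norm Y"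
      using carr pos by (intro max_norm_mult_le[of _ n n _ m]) auto
    also have "\<dots> \<le> real n * \<alpha> * (2 * real n * \<nu> * (\<beta> + real n * \<alpha> * x))"
      using \<alpha> \<alpha>0 nn Y by (intro mult_mono) auto
    finally show ?thesis using 1 by simp
  qed
  finally show ?thesis
    using nn(1) by (simp add: \<nu>_def x_def mult_left_mono)
qed

section \<open>Linear combinations of matrices\<close>

lemma mat_sum_carrier [simp]: "mat_sum n m F I \<in> carrier_mat n m"
  by (simp add: mat_sum_def)

lemma index_mat_sum_smult:
  assumes "\<forall>k\<in>I. S k \<in> carrier_mat n m" "r < n" "c < m"
  shows "mat_sum n m (\<lambda>k. x k \<cdot>\<^sub>m S k) I $$ (r, c) = (\<Sum>k\<in>I. x k * S k $$ (r, c))"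
proof -
  have "(x k \<cdot>\<^sub>m S k) $$ (r, c) = x k * S k $$ (r, c)" if "k \<in> I" for k
    using assms that by auto
  then show ?thesis using assms(2,3) by (simp add: mat_sum_def)
qed

lemma max_norm_mat_sum_le:
  assumes S: "\<forall>k\<in>I. S k \<in> carrier_mat n m" and pos: "0 < n" "0 < m"
    and x: "\<forall>k\<in>I. \<bar>x k\<bar> \<le> \<eta> * w k"
  shows "max_norm (mat_sum n m (\<lambda>k. x k \<cdot>\<^sub>m S k) I) \<le> (\<Sum>k\<in>I. w k * max_norm (S k)) * \<eta>"
proof (rule max_norm_le[OF mat_sum_carrier pos])
  fix r c assume rc: "r < n" "c < m"
  have "\<bar>\<Sum>k\<in>I. x k * S k $$ (r, c)\<bar> \<le> (\<Sum>k\<in>I. (\<eta> * w k) * max_norm (S k))"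
  proof (rule order.trans[OF sum_abs], rule sum_mono)
    fix k assume k: "k \<in> I"
    have "0 \<le> \<bar>x k\<bar>" by simp
    also have "\<dots> \<le> \<eta> * w k" using x k by blast
    finally show "\<bar>x k * S k $$ (r, c)\<bar> \<le> \<eta> * w k * max_norm (S k)"
      unfolding abs_mult using x S k rc abs_le_max_norm[of "S k" n m r c]
      by (intro mult_mono) auto
  qed
  then show "\<bar>mat_sum n m (\<lambda>k. x k \<cdot>\<^sub>m S k) I $$ (r, c)\<bar> \<le> (\<Sum>k\<in>I. w k * max_norm (S k)) * \<eta>"
    unfolding index_mat_sum_smult[OF S rc] by (simp add: sum_distrib_left mult_ac)
qed

lemma index_mult_mat_sum_smult:
  assumes V: "V \<in> carrier_mat n n" and S: "\<forall>k\<in>I. S k \<in> carrier_mat n m"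
    and rc: "r < n" "c < m"
  shows "(V * mat_sum n m (\<lambda>k. x k \<cdot>\<^sub>m S k) I) $$ (r, c) = (\<Sum>k\<in>I. x k * (V * S k) $$ (r, c))"
proof -
  have "(V * mat_sum n m (\<lambda>k. x k \<cdot>\<^sub>m S k) I) $$ (r, c)
      = (\<Sum>l<n. V $$ (r, l) * (\<Sum>k\<in>I. x k * S k $$ (l, c)))"
    using index_mat_sum_smult[OF S _ rc(2)]
    by (simp add: index_mult_mat_sum[OF V mat_sum_carrier rc])
  also have "\<dots> = (\<Sum>k\<in>I. \<Sum>l<n. x k * (V $$ (r, l) * S k $$ (l, c)))"
    by (subst sum.swap) (simp add: sum_distrib_left mult_ac)
  also have "\<dots> = (\<Sum>k\<in>I. x k * (V * S k) $$ (r, c))"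
    using S by (intro sum.cong refl)
      (simp add: index_mult_mat_sum[OF V _ rc] sum_distrib_left)
  finally show ?thesis .
qed

lemma mat_sum_smult_mult:
  assumes D: "\<forall>k\<in>I. D k \<in> carrier_mat n n" and X: "X \<in> carrier_mat n m"
  shows "mat_sum n n (\<lambda>k. x k \<cdot>\<^sub>m D k) I * X = mat_sum n m (\<lambda>k. x k \<cdot>\<^sub>m (D k * X)) I"
proof (rule eq_matI)
  fix r c
  assume "r < dim_row (mat_sum n m (\<lambda>k. x k \<cdot>\<^sub>m (D k * X)) I)"
    "c < dim_col (mat_sum n m (\<lambda>k. x k \<cdot>\<^sub>m (D k * X)) I)"
  then have rc: "r < n" "c < m" by (auto simp: mat_sum_def)
  have DX: "\<forall>k\<in>I. D k * X \<in> carrier_mat n m" using D X by auto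
  have "(mat_sum n n (\<lambda>k. x k \<cdot>\<^sub>m D k) I * X) $$ (r, c)
      = (\<Sum>l<n. (\<Sum>k\<in>I. x k * D k $$ (r, l)) * X $$ (l, c))"
    using index_mat_sum_smult[OF D rc(1)]
    by (simp add: index_mult_mat_sum[OF mat_sum_carrier X rc])
  also have "\<dots> = (\<Sum>k\<in>I. \<Sum>l<n. x k * (D k $$ (r, l) * X $$ (l, c)))"
    by (subst sum.swap) (simp add: sum_distrib_left mult_ac)
  also have "\<dots> = (\<Sum>k\<in>I. x k * (D k * X) $$ (r, c))"
    using D by (intro sum.cong refl)
      (simp add: index_mult_mat_sum[OF _ X rc] sum_distrib_left)
  finally show "(mat_sum n n (\<lambda>k. x k \<cdot>\<^sub>m D k) I * X) $$ (r, c)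
      = mat_sum n m (\<lambda>k. x k \<cdot>\<^sub>m (D k * X)) I $$ (r, c)"
    by (simp only: index_mat_sum_smult[OF DX rc])
qed (use X in \<open>auto simp: mat_sum_def\<close>)

lemma sparse_mat_carrier [simp]: "sparse_mat n m M S \<omega> \<in> carrier_mat n m"
  by (simp add: sparse_mat_def)

lemma sparse_mat_add_minus:
  assumes "\<forall>k\<in>{1..M}. S k \<in> carrier_mat n m"
  shows "sparse_mat n m M S (\<lambda>k. \<omega> k + \<delta> k) - sparse_mat n m M S \<omega>
    = mat_sum n m (\<lambda>k. \<delta> k \<cdot>\<^sub>m S k) {1..M}"
proof (rule eq_matI)
  fix r c assume "r < dim_row (mat_sum n m (\<lambda>k. \<delta> k \<cdot>\<^sub>m S k) {1..M})"
    "c < dim_col (mat_sum n m (\<lambda>k. \<delta> k \<cdot>\<^sub>m S k) {1..M})"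
  then have rc: "r < n" "c < m" by (auto simp: mat_sum_def)
  have "(sparse_mat n m M S (\<lambda>k. \<omega> k + \<delta> k) - sparse_mat n m M S \<omega>) $$ (r, c)
      = sparse_mat n m M S (\<lambda>k. \<omega> k + \<delta> k) $$ (r, c) - sparse_mat n m M S \<omega> $$ (r, c)"
    using rc by (intro index_minus_mat) (auto simp: sparse_mat_def mat_sum_def)
  then show "(sparse_mat n m M S (\<lambda>k. \<omega> k + \<delta> k) - sparse_mat n m M S \<omega>) $$ (r, c)
      = mat_sum n m (\<lambda>k. \<delta> k \<cdot>\<^sub>m S k) {1..M} $$ (r, c)"
    unfolding sparse_mat_def index_mat_sum_smult[OF assms rc]
    by (simp add: sum_subtractf[symmetric] algebra_simps)
qed (auto simp: sparse_mat_def mat_sum_def)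

section \<open>First-order expansion of a quasiseparable matrix\<close>

text \<open>
  The constant depends on the point and on the weights only. In the induction step the new factor
  \<open>x z + \<delta> z\<close> multiplies an expansion \<open>P = P\<^sub>0 + L + R\<close> of the remaining product; the new
  remainder is \<open>\<delta> z (P - P\<^sub>0) + x z R\<close>, in which both terms are of second order.
\<close>

lemma prod_add_first_order:
  fixes x E :: "'i \<Rightarrow> real"
  assumes "finite S" "\<forall>\<zeta>\<in>S. 0 \<le> E \<zeta>"
  shows "\<exists>C\<ge>0. \<forall>\<eta> \<delta>. 0 \<le> \<eta> \<longrightarrow> \<eta> \<le> 1 \<longrightarrow> (\<forall>\<zeta>\<in>S. \<bar>\<delta> \<zeta>\<bar> \<le> \<eta> * E \<zeta>) \<longrightarrow>
    \<bar>(\<Prod>\<zeta>\<in>S. x \<zeta> + \<delta> \<zeta>) - (\<Prod>\<zeta>\<in>S. x \<zeta>) - (\<Sum>\<zeta>\<in>S. \<delta> \<zeta> * (\<Prod>\<xi>\<in>S - {\<zeta>}. x \<xi>))\<bar> \<le> C * \<eta>\<^sup>2"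
  using assms
proof (induction S)
  case empty
  show ?case by (intro exI[of _ 0]) auto
next
  case (insert z S)
  then obtain C where C: "C \<ge> 0"
    "\<And>\<eta> \<delta>. 0 \<le> \<eta> \<Longrightarrow> \<eta> \<le> 1 \<Longrightarrow> (\<forall>\<zeta>\<in>S. \<bar>\<delta> \<zeta>\<bar> \<le> \<eta> * E \<zeta>) \<Longrightarrow>
    \<bar>(\<Prod>\<zeta>\<in>S. x \<zeta> + \<delta> \<zeta>) - (\<Prod>\<zeta>\<in>S. x \<zeta>) - (\<Sum>\<zeta>\<in>S. \<delta> \<zeta> * (\<Prod>\<xi>\<in>S - {\<zeta>}. x \<xi>))\<bar> \<le> C * \<eta>\<^sup>2"
    by auto
  define D where "D = (\<Sum>\<zeta>\<in>S. E \<zeta> * \<bar>\<Prod>\<xi>\<in>S - {\<zeta>}. x \<xi>\<bar>)"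
  have D: "0 \<le> D" unfolding D_def using insert by (intro sum_nonneg) auto
  show ?case
  proof (intro exI[of _ "E z * (D + C) + \<bar>x z\<bar> * C"] conjI allI impI)
    show "0 \<le> E z * (D + C) + \<bar>x z\<bar> * C" using insert C D by simp
    fix \<eta> :: real and \<delta> assume \<eta>: "0 \<le> \<eta>" "\<eta> \<le> 1"
      and \<delta>: "\<forall>\<zeta>\<in>insert z S. \<bar>\<delta> \<zeta>\<bar> \<le> \<eta> * E \<zeta>"
    define P P0 L where "P = (\<Prod>\<zeta>\<in>S. x \<zeta> + \<delta> \<zeta>)" and "P0 = (\<Prod>\<zeta>\<in>S. x \<zeta>)"
      and "L = (\<Sum>\<zeta>\<in>S. \<delta> \<zeta> * (\<Prod>\<xi>\<in>S - {\<zeta>}. x \<xi>))"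
    have R: "\<bar>P - P0 - L\<bar> \<le> C * \<eta>\<^sup>2"
      unfolding P_def P0_def L_def using C(2)[OF \<eta>] \<delta> by auto
    have "\<bar>L\<bar> \<le> (\<Sum>\<zeta>\<in>S. (\<eta> * E \<zeta>) * \<bar>\<Prod>\<xi>\<in>S - {\<zeta>}. x \<xi>\<bar>)"
      unfolding L_def using \<delta>
      by (intro order.trans[OF sum_abs] sum_mono) (auto simp: abs_mult intro!: mult_right_mono)
    also have "\<dots> = D * \<eta>" unfolding D_def by (simp add: sum_distrib_left mult_ac)
    finally have L: "\<bar>L\<bar> \<le> D * \<eta>" .
    have "\<bar>P - P0\<bar> \<le> D * \<eta> + C * \<eta>\<^sup>2" using L R by linarith
    also have "C * \<eta>\<^sup>2 \<le> C * \<eta>"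
      using \<eta> C(1) by (intro mult_left_mono) (auto simp: power2_eq_square mult_left_le)
    finally have PP: "\<bar>P - P0\<bar> \<le> (D + C) * \<eta>" by (simp add: algebra_simps)
    have Lins: "(\<Sum>\<zeta>\<in>S. \<delta> \<zeta> * (\<Prod>\<xi>\<in>insert z S - {\<zeta>}. x \<xi>)) = x z * L"
      unfolding L_def sum_distrib_left
    proof (rule sum.cong)
      fix \<zeta> assume "\<zeta> \<in> S"
      then have "insert z S - {\<zeta>} = insert z (S - {\<zeta>})" using insert by auto
      then show "\<delta> \<zeta> * (\<Prod>\<xi>\<in>insert z S - {\<zeta>}. x \<xi>) = x z * (\<delta> \<zeta> * (\<Prod>\<xi>\<in>S - {\<zeta>}. x \<xi>))"
        using insert by simp
    qed simp
    have "(\<Prod>\<zeta>\<in>insert z S. x \<zeta> + \<delta> \<zeta>) - (\<Prod>\<zeta>\<in>insert z S. x \<zeta>)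
        - (\<Sum>\<zeta>\<in>insert z S. \<delta> \<zeta> * (\<Prod>\<xi>\<in>insert z S - {\<zeta>}. x \<xi>))
        = (x z + \<delta> z) * P - x z * P0 - (\<delta> z * P0 + x z * L)"
      using insert(1,2) by (simp add: Lins P_def P0_def)
    also have "\<dots> = \<delta> z * (P - P0) + x z * (P - P0 - L)" by (simp add: algebra_simps)
    also have "\<bar>\<dots>\<bar> \<le> \<bar>\<delta> z\<bar> * \<bar>P - P0\<bar> + \<bar>x z\<bar> * \<bar>P - P0 - L\<bar>"
      by (rule order.trans[OF abs_triangle_ineq]) (simp add: abs_mult)
    also have "\<dots> \<le> (\<eta> * E z) * ((D + C) * \<eta>) + \<bar>x z\<bar> * (C * \<eta>\<^sup>2)"
      using \<delta> PP R \<eta> insert by (intro add_mono mult_mono) auto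
    also have "\<dots> = (E z * (D + C) + \<bar>x z\<bar> * C) * \<eta>\<^sup>2"
      by (simp add: algebra_simps power2_eq_square)
    finally show "\<bar>(\<Prod>\<zeta>\<in>insert z S. x \<zeta> + \<delta> \<zeta>) - (\<Prod>\<zeta>\<in>insert z S. x \<zeta>)
        - (\<Sum>\<zeta>\<in>insert z S. \<delta> \<zeta> * (\<Prod>\<xi>\<in>insert z S - {\<zeta>}. x \<xi>))\<bar>
        \<le> (E z * (D + C) + \<bar>x z\<bar> * C) * \<eta>\<^sup>2" .
  qed
qed

text \<open>
  The parameters that occur in the entry with (zero-based) row \<open>r\<close> and column \<open>c\<close>. Writing the
  entries as products over sets treats the three cases of the representation alike.
\<close>

definition qs_factors :: "nat \<Rightarrow> nat \<Rightarrow> qs_param set" where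
  "qs_factors r c =
     (if r = c then {Par_d (r + 1)}
      else if c < r then {Par_p (r + 1), Par_q (c + 1)} \<union> Par_a ` {c + 2..r}
      else {Par_g (r + 1), Par_h (c + 1)} \<union> Par_b ` {r + 2..c})"

lemma finite_qs_index: "finite (qs_index n)"
  by (simp add: qs_index_def)

lemma qs_factors_subset: "r < n \<Longrightarrow> c < n \<Longrightarrow> qs_factors r c \<subseteq> qs_index n"
  by (auto simp: qs_factors_def qs_index_def)

lemma finite_qs_factors: "finite (qs_factors r c)"
  by (simp add: qs_factors_def)

lemma qs_mat_carrier [simp]: "qs_mat n \<Omega> \<in> carrier_mat n n"
  by (simp add: qs_mat_def)

lemma index_qs_mat:
  assumes "r < n" "c < n"
  shows "qs_mat n \<Omega> $$ (r, c) = (\<Prod>\<zeta>\<in>qs_factors r c. \<Omega> \<zeta>)"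
proof -
  have a: "(\<Prod>\<zeta>\<in>Par_a ` I. \<Omega> \<zeta>) = (\<Prod>k\<in>I. \<Omega> (Par_a k))" for I
    by (subst prod.reindex) (auto simp: inj_on_def)
  have b: "(\<Prod>\<zeta>\<in>Par_b ` I. \<Omega> \<zeta>) = (\<Prod>k\<in>I. \<Omega> (Par_b k))" for I
    by (subst prod.reindex) (auto simp: inj_on_def)
  have "(\<Prod>\<zeta>\<in>{Par_p i, Par_q j} \<union> Par_a ` {k..l}. \<Omega> \<zeta>)
      = \<Omega> (Par_p i) * (\<Prod>k\<in>{k..l}. \<Omega> (Par_a k)) * \<Omega> (Par_q j)" for i j k l
    by (subst prod.union_disjoint) (auto simp: a)
  moreover have "(\<Prod>\<zeta>\<in>{Par_g i, Par_h j} \<union> Par_b ` {k..l}. \<Omega> \<zeta>)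
      = \<Omega> (Par_g i) * (\<Prod>k\<in>{k..l}. \<Omega> (Par_b k)) * \<Omega> (Par_h j)" for i j k l
    by (subst prod.union_disjoint) (auto simp: b)
  ultimately show ?thesis
    using assms by (auto simp: qs_mat_def qs_factors_def Let_def simp del: Un_insert_left)
qed

text \<open>
  The partial derivative of \<^const>\<open>qs_mat\<close> with respect to \<open>\<zeta>\<close>. The factor \<open>\<Omega> \<zeta>\<close> is left out
  rather than divided off, so that the formula is right for \<open>\<Omega> \<zeta> = 0\<close> too.
\<close>

definition qs_deriv :: "nat \<Rightarrow> (qs_param \<Rightarrow> real) \<Rightarrow> qs_param \<Rightarrow> real mat" where
  "qs_deriv n \<Omega> \<zeta> = mat n n (\<lambda>(r, c).
     if \<zeta> \<in> qs_factors r c then \<Prod>\<xi>\<in>qs_factors r c - {\<zeta>}. \<Omega> \<xi> else 0)"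

lemma qs_deriv_carrier [simp]: "qs_deriv n \<Omega> \<zeta> \<in> carrier_mat n n"
  by (simp add: qs_deriv_def)

text \<open>
  The expansion of a single product is applied to each of the finitely many entries; the sum of
  their constants serves for all of them.
\<close>

lemma qs_mat_first_order:
  assumes n: "0 < n" and E: "\<forall>\<zeta>\<in>qs_index n. 0 \<le> E \<zeta>"
  shows "\<exists>C\<ge>0. \<forall>\<eta> \<delta>. 0 \<le> \<eta> \<longrightarrow> \<eta> \<le> 1 \<longrightarrow> (\<forall>\<zeta>\<in>qs_index n. \<bar>\<delta> \<zeta>\<bar> \<le> \<eta> * E \<zeta>) \<longrightarrow>
    max_norm (qs_mat n (\<lambda>\<zeta>. \<Omega> \<zeta> + \<delta> \<zeta>) - qs_mat n \<Omega>
      - mat_sum n n (\<lambda>\<zeta>. \<delta> \<zeta> \<cdot>\<^sub>m qs_deriv n \<Omega> \<zeta>) (qs_index n)) \<le> C * \<eta>\<^sup>2"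
proof -
  define err where "err r c \<delta> = \<bar>(\<Prod>\<zeta>\<in>qs_factors r c. \<Omega> \<zeta> + \<delta> \<zeta>) - (\<Prod>\<zeta>\<in>qs_factors r c. \<Omega> \<zeta>)
    - (\<Sum>\<zeta>\<in>qs_factors r c. \<delta> \<zeta> * (\<Prod>\<xi>\<in>qs_factors r c - {\<zeta>}. \<Omega> \<xi>))\<bar>" for r c \<delta>
  have "\<exists>C\<ge>0. \<forall>\<eta> \<delta>. 0 \<le> \<eta> \<longrightarrow> \<eta> \<le> 1 \<longrightarrow> (\<forall>\<zeta>\<in>qs_factors r c. \<bar>\<delta> \<zeta>\<bar> \<le> \<eta> * E \<zeta>) \<longrightarrow>
    err r c \<delta> \<le> C * \<eta>\<^sup>2" if "r < n" "c < n" for r c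
    unfolding err_def
    using prod_add_first_order[OF finite_qs_factors[of r c], of E \<Omega>] qs_factors_subset[OF that] E
    by blast
  then obtain C where C: "\<And>r c. r < n \<Longrightarrow> c < n \<Longrightarrow> 0 \<le> C r c"
    "\<And>r c \<eta> \<delta>. r < n \<Longrightarrow> c < n \<Longrightarrow> 0 \<le> \<eta> \<Longrightarrow> \<eta> \<le> 1 \<Longrightarrow>
      (\<forall>\<zeta>\<in>qs_factors r c. \<bar>\<delta> \<zeta>\<bar> \<le> \<eta> * E \<zeta>) \<Longrightarrow> err r c \<delta> \<le> C r c * \<eta>\<^sup>2"
    by metis
  define C' where "C' = (\<Sum>(r, c)\<in>{..<n} \<times> {..<n}. C r c)"
  have C': "C r c \<le> C'" if "r < n" "c < n" for r c
  proof -
    have "(\<lambda>(r, c). C r c) (r, c) \<le> C'"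
      unfolding C'_def using that C(1) by (intro member_le_sum) auto
    then show ?thesis by simp
  qed
  have "0 \<le> C'" unfolding C'_def using C(1) by (intro sum_nonneg) auto
  moreover have "max_norm (qs_mat n (\<lambda>\<zeta>. \<Omega> \<zeta> + \<delta> \<zeta>) - qs_mat n \<Omega>
      - mat_sum n n (\<lambda>\<zeta>. \<delta> \<zeta> \<cdot>\<^sub>m qs_deriv n \<Omega> \<zeta>) (qs_index n)) \<le> C' * \<eta>\<^sup>2"
    (is "max_norm (?A' - ?A - ?A1) \<le> _")
    if \<eta>: "0 \<le> \<eta>" "\<eta> \<le> 1" and \<delta>: "\<forall>\<zeta>\<in>qs_index n. \<bar>\<delta> \<zeta>\<bar> \<le> \<eta> * E \<zeta>" for \<eta> \<delta>
  proof (rule max_norm_le[OF _ n n])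
    show "?A' - ?A - ?A1 \<in> carrier_mat n n" by (intro minus_carrier_mat mat_sum_carrier)
    fix r c assume rc: "r < n" "c < n"
    have "?A1 $$ (r, c) = (\<Sum>\<zeta>\<in>qs_index n. \<delta> \<zeta> * qs_deriv n \<Omega> \<zeta> $$ (r, c))"
      by (rule index_mat_sum_smult) (use rc in auto)
    also have "\<dots> = (\<Sum>\<zeta>\<in>qs_factors r c. \<delta> \<zeta> * qs_deriv n \<Omega> \<zeta> $$ (r, c))"
      using qs_factors_subset[OF rc] rc
      by (intro sum.mono_neutral_right finite_qs_index) (auto simp: qs_deriv_def)
    also have "\<dots> = (\<Sum>\<zeta>\<in>qs_factors r c. \<delta> \<zeta> * (\<Prod>\<xi>\<in>qs_factors r c - {\<zeta>}. \<Omega> \<xi>))"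
      using rc by (intro sum.cong) (auto simp: qs_deriv_def)
    finally have A1: "?A1 $$ (r, c) = \<dots>" .
    have "(?A' - ?A - ?A1) $$ (r, c) = ?A' $$ (r, c) - ?A $$ (r, c) - ?A1 $$ (r, c)"
      using rc by (simp add: mat_sum_def qs_mat_def)
    then have "\<bar>(?A' - ?A - ?A1) $$ (r, c)\<bar> = err r c \<delta>"
      by (simp only: A1 index_qs_mat[OF rc] err_def)
    also have "\<dots> \<le> C r c * \<eta>\<^sup>2"
      using \<delta> qs_factors_subset[OF rc] by (intro C(2) rc \<eta>) auto
    also have "\<dots> \<le> C' * \<eta>\<^sup>2" using C'[OF rc] by (intro mult_right_mono) auto
    finally show "\<bar>(?A' - ?A - ?A1) $$ (r, c)\<bar> \<le> C' * \<eta>\<^sup>2" .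
  qed
  ultimately show ?thesis by blast
qed

section \<open>The limit of the relative changes\<close>

text \<open>
  This is what the perturbation bound for linear systems says about the parameters: for small
  \<open>\<eta>\<close> every perturbation within the bounds leads to a solvable system, and the change of the solution
  agrees up to \<open>C \<eta>\<^sup>2\<close> with a linear form in the perturbations \<open>\<delta>\<close> and \<open>\<epsilon>\<close>. That \<open>C\<close> and
  \<open>\<eta>\<^sub>0\<close> do not depend on the perturbation is essential for passing to the supremum.
\<close>

lemma qs_perturbed_solution:
  assumes pos: "0 < n" "0 < m"
    and S: "\<forall>k\<in>{1..M}. S k \<in> carrier_mat n m"
    and X: "X \<in> carrier_mat n m" and eq: "qs_mat n \<Omega> * X = sparse_mat n m M S \<omega>"
    and V: "V \<in> carrier_mat n n" "V * qs_mat n \<Omega> = 1\<^sub>m n"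
    and f: "\<forall>k\<in>{1..M}. 0 \<le> f k" and E: "\<forall>\<zeta>\<in>qs_index n. 0 \<le> E \<zeta>"
  obtains C \<eta>\<^sub>0 where "0 \<le> C" "0 < \<eta>\<^sub>0"
    "\<And>\<eta> \<delta> \<epsilon>. 0 < \<eta> \<Longrightarrow> \<eta> \<le> \<eta>\<^sub>0 \<Longrightarrow> \<forall>\<zeta>\<in>qs_index n. \<bar>\<delta> \<zeta>\<bar> \<le> \<eta> * E \<zeta> \<Longrightarrow>
      \<exists>Y\<in>carrier_mat n m. qs_mat n (\<lambda>\<zeta>. \<Omega> \<zeta> + \<delta> \<zeta>) * (X + Y) = sparse_mat n m M S (\<lambda>k. \<omega> k + \<epsilon> k)"
    "\<And>\<eta> \<delta> \<epsilon> Y r c. 0 < \<eta> \<Longrightarrow> \<eta> \<le> \<eta>\<^sub>0 \<Longrightarrow> \<forall>\<zeta>\<in>qs_index n. \<bar>\<delta> \<zeta>\<bar> \<le> \<eta> * E \<zeta> \<Longrightarrow>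
      \<forall>k\<in>{1..M}. \<bar>\<epsilon> k\<bar> \<le> \<eta> * f k \<Longrightarrow> Y \<in> carrier_mat n m \<Longrightarrow>
      qs_mat n (\<lambda>\<zeta>. \<Omega> \<zeta> + \<delta> \<zeta>) * (X + Y) = sparse_mat n m M S (\<lambda>k. \<omega> k + \<epsilon> k) \<Longrightarrow>
      r < n \<Longrightarrow> c < m \<Longrightarrow>
      \<bar>Y $$ (r, c) - ((\<Sum>k\<in>{1..M}. \<epsilon> k * (V * S k) $$ (r, c))
        - (\<Sum>\<zeta>\<in>qs_index n. \<delta> \<zeta> * (V * qs_deriv n \<Omega> \<zeta> * X) $$ (r, c)))\<bar> \<le> C * \<eta>\<^sup>2"
proof -
  let ?A = "qs_mat n \<Omega>"
  let ?A' = "\<lambda>\<delta>. qs_mat n (\<lambda>\<zeta>. \<Omega> \<zeta> + \<delta> \<zeta>)"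
  let ?B' = "\<lambda>\<epsilon>. sparse_mat n m M S (\<lambda>k. \<omega> k + \<epsilon> k)"
  let ?A1 = "\<lambda>\<delta>. mat_sum n n (\<lambda>\<zeta>. \<delta> \<zeta> \<cdot>\<^sub>m qs_deriv n \<Omega> \<zeta>) (qs_index n)"
  obtain C0 where C0: "0 \<le> C0"
    "\<And>\<eta> \<delta>. 0 \<le> \<eta> \<Longrightarrow> \<eta> \<le> 1 \<Longrightarrow> \<forall>\<zeta>\<in>qs_index n. \<bar>\<delta> \<zeta>\<bar> \<le> \<eta> * E \<zeta> \<Longrightarrow>
      max_norm (?A' \<delta> - ?A - ?A1 \<delta>) \<le> C0 * \<eta>\<^sup>2"
    using qs_mat_first_order[OF pos(1) E] by metis
  define C1 C2 where "C1 = C0 + (\<Sum>\<zeta>\<in>qs_index n. E \<zeta> * max_norm (qs_deriv n \<Omega> \<zeta>))"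
    and "C2 = (\<Sum>k\<in>{1..M}. f k * max_norm (S k))"
  define \<nu> x where "\<nu> = max_norm V" and "x = max_norm X"
  have nn: "0 \<le> \<nu>" "0 \<le> x"
    unfolding \<nu>_def x_def by (rule max_norm_nonneg[OF V(1) pos(1,1)] max_norm_nonneg[OF X pos])+
  have C1: "0 \<le> C1" unfolding C1_def
    using C0(1) E max_norm_nonneg[OF qs_deriv_carrier pos(1,1)]
    by (intro add_nonneg_nonneg sum_nonneg mult_nonneg_nonneg) auto
  have C2: "0 \<le> C2" unfolding C2_def
    using f S max_norm_nonneg[OF _ pos]
    by (intro sum_nonneg mult_nonneg_nonneg) auto
  define q where "q = 2 * ((real n)\<^sup>2 * \<nu> * C1)"
  have q: "0 \<le> q" unfolding q_def using nn C1 by simp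
  \<comment> \<open>For \<open>\<eta> \<le> \<eta>\<^sub>0\<close> one has \<open>\<eta> \<le> 1\<close>, hence \<open>\<eta>\<^sup>2 \<le> \<eta>\<close>, and \<open>q \<eta> \<le> 1\<close>. The quantity that has to be
    at most one half in the a priori bound is at most \<open>q \<eta> / 2\<close>.\<close>
  define \<eta>\<^sub>0 where "\<eta>\<^sub>0 = 1 / (1 + q)"
  have \<eta>0: "0 < \<eta>\<^sub>0" "\<eta>\<^sub>0 \<le> 1" "q * \<eta>\<^sub>0 \<le> 1"
    unfolding \<eta>\<^sub>0_def using q by (auto simp: field_simps)
  define C where "C = real n * \<nu> * (real n * C0 * x + real n * C1 * (2 * real n * \<nu> * (C2 + real n * C1 * x)))"
  have A1c: "?A1 \<delta> \<in> carrier_mat n n" for \<delta> by simp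
  have \<alpha>: "max_norm (?A' \<delta> - ?A) \<le> C1 * \<eta>"
    if \<eta>: "0 < \<eta>" "\<eta> \<le> \<eta>\<^sub>0" and \<delta>: "\<forall>\<zeta>\<in>qs_index n. \<bar>\<delta> \<zeta>\<bar> \<le> \<eta> * E \<zeta>" for \<eta> \<delta>
  proof -
    have "max_norm (?A' \<delta> - ?A) \<le> max_norm (?A' \<delta> - ?A - ?A1 \<delta>) + max_norm (?A1 \<delta>)"
      by (intro max_norm_triangle[of _ n n] minus_carrier_mat pos) auto
    also have "\<dots> \<le> C0 * \<eta>\<^sup>2 + (\<Sum>\<zeta>\<in>qs_index n. E \<zeta> * max_norm (qs_deriv n \<Omega> \<zeta>)) * \<eta>"
      using \<eta> \<eta>0 by (intro add_mono C0(2) \<delta> max_norm_mat_sum_le pos) auto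
    also have "C0 * \<eta>\<^sup>2 \<le> C0 * \<eta>"
      using \<eta> \<eta>0 C0(1) by (intro mult_left_mono) (auto simp: power2_eq_square mult_left_le)
    finally show ?thesis by (simp add: C1_def algebra_simps)
  qed
  have small: "(real n)\<^sup>2 * max_norm V * max_norm (?A' \<delta> - ?A) \<le> 1 / 2"
    if \<eta>: "0 < \<eta>" "\<eta> \<le> \<eta>\<^sub>0" and \<delta>: "\<forall>\<zeta>\<in>qs_index n. \<bar>\<delta> \<zeta>\<bar> \<le> \<eta> * E \<zeta>" for \<eta> \<delta>
  proof -
    have "(real n)\<^sup>2 * max_norm V * max_norm (?A' \<delta> - ?A) \<le> (real n)\<^sup>2 * max_norm V * (C1 * \<eta>)"
      using nn(1) unfolding \<nu>_def by (intro mult_left_mono \<alpha>[OF that]) simp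
    also have "\<dots> = 1 / 2 * (q * \<eta>)" by (simp add: q_def \<nu>_def)
    also have "q * \<eta> \<le> q * \<eta>\<^sub>0" using q \<eta> by (intro mult_left_mono)
    finally show ?thesis using \<eta>0(3) by linarith
  qed
  show thesis
  proof (rule that[of C \<eta>\<^sub>0])
    show "0 \<le> C" unfolding C_def using nn C0(1) C1 C2 by simp
    show "0 < \<eta>\<^sub>0" by (fact \<eta>0(1))
    fix \<eta> \<delta> \<epsilon>
    assume \<eta>: "0 < \<eta>" "\<eta> \<le> \<eta>\<^sub>0" and \<delta>: "\<forall>\<zeta>\<in>qs_index n. \<bar>\<delta> \<zeta>\<bar> \<le> \<eta> * E \<zeta>"
    obtain Z where Z: "Z \<in> carrier_mat n m" "?A' \<delta> * Z = ?B' \<epsilon>"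
      using perturbed_system_solvable[OF V(1) qs_mat_carrier qs_mat_carrier
          sparse_mat_carrier pos(1) V(2) small[OF \<eta> \<delta>]] by blast
    have "X + (Z - X) = Z" using X Z(1) by (intro eq_matI) auto
    then show "\<exists>Y\<in>carrier_mat n m. ?A' \<delta> * (X + Y) = ?B' \<epsilon>"
      using X Z by (intro bexI[of _ "Z - X"] minus_carrier_mat) simp_all
  next
    fix \<eta> \<delta> \<epsilon> Y r c
    assume \<eta>: "0 < \<eta>" "\<eta> \<le> \<eta>\<^sub>0" and \<delta>: "\<forall>\<zeta>\<in>qs_index n. \<bar>\<delta> \<zeta>\<bar> \<le> \<eta> * E \<zeta>"
      and \<epsilon>: "\<forall>k\<in>{1..M}. \<bar>\<epsilon> k\<bar> \<le> \<eta> * f k"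
      and Y: "Y \<in> carrier_mat n m" and eqY: "?A' \<delta> * (X + Y) = ?B' \<epsilon>"
      and rc: "r < n" "c < m"
    let ?DB = "mat_sum n m (\<lambda>k. \<epsilon> k \<cdot>\<^sub>m S k) {1..M}"
    have DB: "?B' \<epsilon> - ?A * X = ?DB"
      unfolding eq by (rule sparse_mat_add_minus[OF S])
    have \<beta>: "max_norm (?B' \<epsilon> - ?A * X) \<le> C2 * \<eta>"
      unfolding DB C2_def by (rule max_norm_mat_sum_le[OF S pos \<epsilon>])
    have \<rho>: "max_norm (?A' \<delta> - ?A - ?A1 \<delta>) \<le> C0 * \<eta>\<^sup>2"
      using \<eta> \<eta>0 by (intro C0(2) \<delta>) auto
    define L where "L = V * (?B' \<epsilon> - ?A * X - ?A1 \<delta> * X)"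
    have Lc: "L \<in> carrier_mat n m"
      unfolding L_def using V(1) X A1c by (intro mult_carrier_mat[of _ n n] minus_carrier_mat)
    have "max_norm (Y - L) \<le> real n * max_norm V * (real n * (C0 * \<eta>\<^sup>2) * max_norm X +
      real n * (C1 * \<eta>) * (2 * real n * max_norm V * (C2 * \<eta> + real n * (C1 * \<eta>) * max_norm X)))"
      unfolding L_def
      by (rule perturbed_solution_first_order[OF V(1) qs_mat_carrier qs_mat_carrier A1c
          sparse_mat_carrier X Y pos V(2) eqY small[OF \<eta> \<delta>] \<alpha>[OF \<eta> \<delta>] \<rho> \<beta>])
    also have "\<dots> = C * \<eta>\<^sup>2"
      unfolding C_def \<nu>_def x_def by (simp add: algebra_simps power2_eq_square)
    finally have err: "max_norm (Y - L) \<le> C * \<eta>\<^sup>2" .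
    have DX: "\<forall>\<zeta>\<in>qs_index n. qs_deriv n \<Omega> \<zeta> * X \<in> carrier_mat n m"
      using X by (auto intro: mult_carrier_mat[OF qs_deriv_carrier])
    have A1X: "?A1 \<delta> * X = mat_sum n m (\<lambda>\<zeta>. \<delta> \<zeta> \<cdot>\<^sub>m (qs_deriv n \<Omega> \<zeta> * X)) (qs_index n)"
      by (intro mat_sum_smult_mult X) simp
    have "L = V * ?DB - V * (?A1 \<delta> * X)"
      unfolding L_def DB
      by (rule mult_minus_distrib_mat[OF V(1) mat_sum_carrier mult_carrier_mat[OF A1c X]])
    then have "L $$ (r, c) = (V * ?DB) $$ (r, c) - (V * (?A1 \<delta> * X)) $$ (r, c)"
      using V(1) X rc by (simp del: index_mult_mat(1))
    also have "\<dots> = (\<Sum>k\<in>{1..M}. \<epsilon> k * (V * S k) $$ (r, c))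
        - (\<Sum>\<zeta>\<in>qs_index n. \<delta> \<zeta> * (V * (qs_deriv n \<Omega> \<zeta> * X)) $$ (r, c))"
      unfolding A1X by (simp only: index_mult_mat_sum_smult[OF V(1) S rc]
          index_mult_mat_sum_smult[OF V(1) DX rc])
    also have "\<dots> = (\<Sum>k\<in>{1..M}. \<epsilon> k * (V * S k) $$ (r, c))
        - (\<Sum>\<zeta>\<in>qs_index n. \<delta> \<zeta> * (V * qs_deriv n \<Omega> \<zeta> * X) $$ (r, c))"
      by (simp only: assoc_mult_mat[OF V(1) qs_deriv_carrier X])
    finally have L: "L $$ (r, c) = \<dots>" .
    have "\<bar>Y $$ (r, c) - L $$ (r, c)\<bar> = \<bar>(Y - L) $$ (r, c)\<bar>"
      using Y Lc rc by simp
    also have "\<dots> \<le> max_norm (Y - L)"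
      using Lc rc by (intro abs_le_max_norm minus_carrier_mat)
    finally show "\<bar>Y $$ (r, c) - ((\<Sum>k\<in>{1..M}. \<epsilon> k * (V * S k) $$ (r, c))
        - (\<Sum>\<zeta>\<in>qs_index n. \<delta> \<zeta> * (V * qs_deriv n \<Omega> \<zeta> * X) $$ (r, c)))\<bar> \<le> C * \<eta>\<^sup>2"
      using err unfolding L by linarith
  qed
qed

text \<open>
  For nonnegative weights the entries are the maxima, over the perturbations bounded by the weights (that is, \<open>\<eta> = 1\<close>),
  of the absolute value of the linear form that approximates the change of the solution. The
  argument \<open>V\<close> stands for the inverse of \<open>A\<close>.
\<close>

definition qs_sensitivity ::
    "nat \<Rightarrow> nat \<Rightarrow> nat \<Rightarrow> (nat \<Rightarrow> real mat) \<Rightarrow> (qs_param \<Rightarrow> real) \<Rightarrow> (qs_param \<Rightarrow> real) \<Rightarrow>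
     (nat \<Rightarrow> real) \<Rightarrow> real mat \<Rightarrow> real mat \<Rightarrow> real mat" where
  "qs_sensitivity n m M S \<Omega> E f X V = mat n m (\<lambda>(r, c).
     (\<Sum>k\<in>{1..M}. f k * \<bar>(V * S k) $$ (r, c)\<bar>)
     + (\<Sum>\<zeta>\<in>qs_index n. E \<zeta> * \<bar>(V * qs_deriv n \<Omega> \<zeta> * X) $$ (r, c)\<bar>))"

lemma tendsto_of_linear_error:
  fixes F :: "real \<Rightarrow> ereal"
  assumes "\<forall>\<^sub>F \<eta> in at_right 0. ereal (K - C * \<eta>) \<le> F \<eta> \<and> F \<eta> \<le> ereal (K + C * \<eta>)"
  shows "(F \<longlongrightarrow> ereal K) (at_right 0)"
proof (rule tendsto_sandwich)
  have "((\<lambda>\<eta>. K - C * \<eta>) \<longlongrightarrow> K - C * 0) (at_right 0)"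
    by (intro tendsto_intros)
  then show "((\<lambda>\<eta>. ereal (K - C * \<eta>)) \<longlongrightarrow> ereal K) (at_right 0)"
    by (intro tendsto_ereal) simp
  have "((\<lambda>\<eta>. K + C * \<eta>) \<longlongrightarrow> K + C * 0) (at_right 0)"
    by (intro tendsto_intros)
  then show "((\<lambda>\<eta>. ereal (K + C * \<eta>)) \<longlongrightarrow> ereal K) (at_right 0)"
    by (intro tendsto_ereal) simp
qed (use assms in \<open>auto elim: eventually_mono\<close>)

lemma weighted_sum_le:
  fixes a x w :: "'i \<Rightarrow> real"
  assumes "\<forall>i\<in>I. \<bar>x i\<bar> \<le> \<eta> * w i"
  shows "\<bar>\<Sum>i\<in>I. x i * a i\<bar> \<le> \<eta> * (\<Sum>i\<in>I. w i * \<bar>a i\<bar>)"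
proof -
  have "\<bar>\<Sum>i\<in>I. x i * a i\<bar> \<le> (\<Sum>i\<in>I. (\<eta> * w i) * \<bar>a i\<bar>)"
    using assms by (intro order.trans[OF sum_abs] sum_mono) (auto simp: abs_mult intro!: mult_right_mono)
  then show ?thesis by (simp add: sum_distrib_left mult_ac)
qed

text \<open>
  The linear form attains its maximal modulus in a given entry when all perturbations are extremal
  with suitable signs. Choosing the entry where the sensitivity is largest gives the lower bound;
  the upper bound is the triangle inequality. Both hold up to \<open>O(\<eta>)\<close> after division by \<open>\<eta>\<close>.
\<close>

lemma qs_relative_change_tendsto:
  assumes pos: "0 < n" "0 < m"
    and S: "\<forall>k\<in>{1..M}. S k \<in> carrier_mat n m"
    and X: "X \<in> carrier_mat n m" and X0: "0 < max_norm X"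
    and eq: "qs_mat n \<Omega> * X = sparse_mat n m M S \<omega>"
    and V: "V \<in> carrier_mat n n" "V * qs_mat n \<Omega> = 1\<^sub>m n"
    and f: "\<forall>k\<in>{1..M}. 0 \<le> f k" and E: "\<forall>\<zeta>\<in>qs_index n. 0 \<le> E \<zeta>"
  shows "(qs_relative_change n m M S \<Omega> \<omega> E f X \<longlongrightarrow>
    ereal (1 / max_norm X * max_norm (qs_sensitivity n m M S \<Omega> E f X V))) (at_right 0)"
proof -
  define x where "x = max_norm X"
  define T where "T = qs_sensitivity n m M S \<Omega> E f X V"
  have x: "0 < x" using X0 by (simp add: x_def)
  have Tc: "T \<in> carrier_mat n m" by (simp add: T_def qs_sensitivity_def)
  have T: "T $$ (r, c) = (\<Sum>k\<in>{1..M}. f k * \<bar>(V * S k) $$ (r, c)\<bar>)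
     + (\<Sum>\<zeta>\<in>qs_index n. E \<zeta> * \<bar>(V * qs_deriv n \<Omega> \<zeta> * X) $$ (r, c)\<bar>)" if "r < n" "c < m" for r c
    using that by (simp add: T_def qs_sensitivity_def)
  have T0: "0 \<le> T $$ (r, c)" if "r < n" "c < m" for r c
    unfolding T[OF that] using f E by (intro add_nonneg_nonneg sum_nonneg mult_nonneg_nonneg) auto
  obtain C \<eta>\<^sub>0 where C: "0 \<le> C" "0 < \<eta>\<^sub>0"
    and solv: "\<And>\<eta> \<delta> \<epsilon>. 0 < \<eta> \<Longrightarrow> \<eta> \<le> \<eta>\<^sub>0 \<Longrightarrow> \<forall>\<zeta>\<in>qs_index n. \<bar>\<delta> \<zeta>\<bar> \<le> \<eta> * E \<zeta> \<Longrightarrow>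
      \<exists>Y\<in>carrier_mat n m. qs_mat n (\<lambda>\<zeta>. \<Omega> \<zeta> + \<delta> \<zeta>) * (X + Y) = sparse_mat n m M S (\<lambda>k. \<omega> k + \<epsilon> k)"
    and err: "\<And>\<eta> \<delta> \<epsilon> Y r c. 0 < \<eta> \<Longrightarrow> \<eta> \<le> \<eta>\<^sub>0 \<Longrightarrow> \<forall>\<zeta>\<in>qs_index n. \<bar>\<delta> \<zeta>\<bar> \<le> \<eta> * E \<zeta> \<Longrightarrow>
      \<forall>k\<in>{1..M}. \<bar>\<epsilon> k\<bar> \<le> \<eta> * f k \<Longrightarrow> Y \<in> carrier_mat n m \<Longrightarrow>
      qs_mat n (\<lambda>\<zeta>. \<Omega> \<zeta> + \<delta> \<zeta>) * (X + Y) = sparse_mat n m M S (\<lambda>k. \<omega> k + \<epsilon> k) \<Longrightarrow>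
      r < n \<Longrightarrow> c < m \<Longrightarrow>
      \<bar>Y $$ (r, c) - ((\<Sum>k\<in>{1..M}. \<epsilon> k * (V * S k) $$ (r, c))
        - (\<Sum>\<zeta>\<in>qs_index n. \<delta> \<zeta> * (V * qs_deriv n \<Omega> \<zeta> * X) $$ (r, c)))\<bar> \<le> C * \<eta>\<^sup>2"
    using qs_perturbed_solution[OF pos S X eq V f E] by blast
  have upper: "max_norm Y \<le> \<eta> * max_norm T + C * \<eta>\<^sup>2"
    if \<eta>: "0 < \<eta>" "\<eta> \<le> \<eta>\<^sub>0" and \<delta>: "\<forall>\<zeta>\<in>qs_index n. \<bar>\<delta> \<zeta>\<bar> \<le> \<eta> * E \<zeta>"
      and \<epsilon>: "\<forall>k\<in>{1..M}. \<bar>\<epsilon> k\<bar> \<le> \<eta> * f k" and Y: "Y \<in> carrier_mat n m"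
      and eqY: "qs_mat n (\<lambda>\<zeta>. \<Omega> \<zeta> + \<delta> \<zeta>) * (X + Y) = sparse_mat n m M S (\<lambda>k. \<omega> k + \<epsilon> k)"
    for \<eta> \<delta> \<epsilon> Y
  proof (rule max_norm_le[OF Y pos])
    fix r c assume rc: "r < n" "c < m"
    have "\<bar>\<Sum>k\<in>{1..M}. \<epsilon> k * (V * S k) $$ (r, c)\<bar> \<le> \<eta> * (\<Sum>k\<in>{1..M}. f k * \<bar>(V * S k) $$ (r, c)\<bar>)"
      by (rule weighted_sum_le[OF \<epsilon>])
    moreover have "\<bar>\<Sum>\<zeta>\<in>qs_index n. \<delta> \<zeta> * (V * qs_deriv n \<Omega> \<zeta> * X) $$ (r, c)\<bar>
        \<le> \<eta> * (\<Sum>\<zeta>\<in>qs_index n. E \<zeta> * \<bar>(V * qs_deriv n \<Omega> \<zeta> * X) $$ (r, c)\<bar>)"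
      by (rule weighted_sum_le[OF \<delta>])
    moreover have "\<eta> * T $$ (r, c) \<le> \<eta> * max_norm T"
      using abs_le_max_norm[OF Tc rc] \<eta> by (intro mult_left_mono) auto
    ultimately show "\<bar>Y $$ (r, c)\<bar> \<le> \<eta> * max_norm T + C * \<eta>\<^sup>2"
      using err[OF \<eta> \<delta> \<epsilon> Y eqY rc] unfolding T[OF rc] distrib_left by linarith
  qed
  have lower: "\<exists>Y \<delta> \<epsilon>. Y \<in> carrier_mat n m \<and>
      qs_mat n (\<lambda>\<zeta>. \<Omega> \<zeta> + \<delta> \<zeta>) * (X + Y) = sparse_mat n m M S (\<lambda>k. \<omega> k + \<epsilon> k) \<and>
      (\<forall>\<zeta>\<in>qs_index n. \<bar>\<delta> \<zeta>\<bar> \<le> \<eta> * E \<zeta>) \<and> (\<forall>k\<in>{1..M}. \<bar>\<epsilon> k\<bar> \<le> \<eta> * f k) \<and>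
      \<eta> * max_norm T - C * \<eta>\<^sup>2 \<le> max_norm Y"
    if \<eta>: "0 < \<eta>" "\<eta> \<le> \<eta>\<^sub>0" for \<eta>
  proof -
    obtain r c where rc: "r < n" "c < m" and "max_norm T = \<bar>T $$ (r, c)\<bar>"
      by (rule max_norm_attained[OF Tc pos])
    then have maxT: "max_norm T = T $$ (r, c)" using T0 by simp
    \<comment> \<open>The signs that make every summand of the linear form nonnegative; the perturbation of the
      matrix enters the linear form with a minus sign.\<close>
    define \<delta> \<epsilon> where "\<delta> \<zeta> = - (\<eta> * E \<zeta> * sgn ((V * qs_deriv n \<Omega> \<zeta> * X) $$ (r, c)))"
      and "\<epsilon> k = \<eta> * f k * sgn ((V * S k) $$ (r, c))" for \<zeta> k
    have \<delta>: "\<forall>\<zeta>\<in>qs_index n. \<bar>\<delta> \<zeta>\<bar> \<le> \<eta> * E \<zeta>"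
      using \<eta> E by (auto simp: \<delta>_def abs_mult abs_sgn_eq)
    have \<epsilon>: "\<forall>k\<in>{1..M}. \<bar>\<epsilon> k\<bar> \<le> \<eta> * f k"
      using \<eta> f by (auto simp: \<epsilon>_def abs_mult abs_sgn_eq)
    obtain Y where Y: "Y \<in> carrier_mat n m"
      "qs_mat n (\<lambda>\<zeta>. \<Omega> \<zeta> + \<delta> \<zeta>) * (X + Y) = sparse_mat n m M S (\<lambda>k. \<omega> k + \<epsilon> k)"
      using solv[OF \<eta> \<delta>] by blast
    have "(\<Sum>k\<in>{1..M}. \<epsilon> k * (V * S k) $$ (r, c))
        - (\<Sum>\<zeta>\<in>qs_index n. \<delta> \<zeta> * (V * qs_deriv n \<Omega> \<zeta> * X) $$ (r, c)) = \<eta> * T $$ (r, c)"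
      unfolding T[OF rc] \<delta>_def \<epsilon>_def
      by (simp add: sum_distrib_left distrib_left sum_negf mult.assoc sgn_mult_self_eq
          mult_sgn_abs abs_sgn mult.commute[of "sgn _"] del: index_mult_mat(1))
    then have "\<eta> * max_norm T - C * \<eta>\<^sup>2 \<le> \<bar>Y $$ (r, c)\<bar>"
      using err[OF \<eta> \<delta> \<epsilon> Y rc] unfolding maxT by linarith
    also have "\<dots> \<le> max_norm Y" by (rule abs_le_max_norm[OF Y(1) rc])
    finally show ?thesis using Y \<delta> \<epsilon> by blast
  qed
  have bound: "ereal (1 / x * max_norm T - C / x * \<eta>) \<le> qs_relative_change n m M S \<Omega> \<omega> E f X \<eta> \<and>
      qs_relative_change n m M S \<Omega> \<omega> E f X \<eta> \<le> ereal (1 / x * max_norm T + C / x * \<eta>)"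
    if \<eta>: "0 < \<eta>" "\<eta> \<le> \<eta>\<^sub>0" for \<eta>
  proof
    obtain Y \<delta> \<epsilon> where Y: "Y \<in> carrier_mat n m"
      "qs_mat n (\<lambda>\<zeta>. \<Omega> \<zeta> + \<delta> \<zeta>) * (X + Y) = sparse_mat n m M S (\<lambda>k. \<omega> k + \<epsilon> k)"
      "\<forall>\<zeta>\<in>qs_index n. \<bar>\<delta> \<zeta>\<bar> \<le> \<eta> * E \<zeta>" "\<forall>k\<in>{1..M}. \<bar>\<epsilon> k\<bar> \<le> \<eta> * f k"
      and le: "\<eta> * max_norm T - C * \<eta>\<^sup>2 \<le> max_norm Y"
      using lower[OF \<eta>] by blast
    have "1 / x * max_norm T - C / x * \<eta> = 1 / \<eta> * ((\<eta> * max_norm T - C * \<eta>\<^sup>2) / x)"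
      using \<eta> x by (simp add: field_simps power2_eq_square)
    also have "\<dots> \<le> 1 / \<eta> * (max_norm Y / x)"
      using \<eta> x le by (intro mult_left_mono divide_right_mono) auto
    finally have "ereal (1 / x * max_norm T - C / x * \<eta>) \<le> ereal (1 / \<eta> * (max_norm Y / x))"
      by simp
    also have "\<dots> \<le> qs_relative_change n m M S \<Omega> \<omega> E f X \<eta>"
      unfolding qs_relative_change_def x_def using Y by (intro Sup_upper) blast
    finally show "ereal (1 / x * max_norm T - C / x * \<eta>) \<le> qs_relative_change n m M S \<Omega> \<omega> E f X \<eta>" .
    show "qs_relative_change n m M S \<Omega> \<omega> E f X \<eta> \<le> ereal (1 / x * max_norm T + C / x * \<eta>)"
      unfolding qs_relative_change_def
    proof (rule Sup_least, elim CollectE exE conjE)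
      fix z Y \<delta> \<epsilon>
      assume z: "z = ereal (1 / \<eta> * (max_norm Y / max_norm X))"
        and Y: "Y \<in> carrier_mat n m"
          "qs_mat n (\<lambda>\<zeta>. \<Omega> \<zeta> + \<delta> \<zeta>) * (X + Y) = sparse_mat n m M S (\<lambda>k. \<omega> k + \<epsilon> k)"
          "\<forall>\<zeta>\<in>qs_index n. \<bar>\<delta> \<zeta>\<bar> \<le> \<eta> * E \<zeta>" "\<forall>k\<in>{1..M}. \<bar>\<epsilon> k\<bar> \<le> \<eta> * f k"
      have "1 / \<eta> * (max_norm Y / x) \<le> 1 / \<eta> * ((\<eta> * max_norm T + C * \<eta>\<^sup>2) / x)"
        using \<eta> x upper[OF \<eta> Y(3,4,1,2)] by (intro mult_left_mono divide_right_mono) auto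
      also have "\<dots> = 1 / x * max_norm T + C / x * \<eta>"
        using \<eta> x by (simp add: field_simps power2_eq_square)
      finally show "z \<le> ereal (1 / x * max_norm T + C / x * \<eta>)"
        by (simp add: z x_def)
    qed
  qed
  have "\<forall>\<^sub>F \<eta> in at_right 0. 0 < \<eta> \<and> \<eta> \<le> \<eta>\<^sub>0"
    unfolding eventually_at_right_field using C(2) by (auto intro!: exI[of _ \<eta>\<^sub>0])
  then have "\<forall>\<^sub>F \<eta> in at_right 0.
      ereal (1 / x * max_norm T - C / x * \<eta>) \<le> qs_relative_change n m M S \<Omega> \<omega> E f X \<eta> \<and>
      qs_relative_change n m M S \<Omega> \<omega> E f X \<eta> \<le> ereal (1 / x * max_norm T + C / x * \<eta>)"
    by (rule eventually_mono) (use bound in blast)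
  then show ?thesis
    unfolding x_def T_def by (rule tendsto_of_linear_error)
qed

section \<open>Evaluation of the sensitivities\<close>

lemma mat_abs_carrier [simp]: "mat_abs P \<in> carrier_mat n m \<longleftrightarrow> P \<in> carrier_mat n m"
  unfolding mat_abs_def carrier_mat_def by simp

lemma index_mat_abs: "P \<in> carrier_mat n m \<Longrightarrow> r < n \<Longrightarrow> c < m \<Longrightarrow> mat_abs P $$ (r, c) = \<bar>P $$ (r, c)\<bar>"
  by (simp add: mat_abs_def)

lemma index_mult_abs_diag:
  assumes P: "P \<in> carrier_mat n n" and Y: "Y \<in> carrier_mat n m" and rc: "r < n" "c < m"
  shows "(mat_abs P * mat_abs (mat_diag n d) * mat_abs Y) $$ (r, c)
    = (\<Sum>i<n. \<bar>P $$ (r, i)\<bar> * \<bar>d i\<bar> * \<bar>Y $$ (i, c)\<bar>)"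
proof -
  have Pc: "mat_abs P \<in> carrier_mat n n" and Yc: "mat_abs Y \<in> carrier_mat n m"
    using P Y by (simp_all only: mat_abs_carrier)
  have D: "mat_abs (mat_diag n d) = mat_diag n (\<lambda>i. \<bar>d i\<bar>)"
    by (rule eq_matI) (simp_all add: mat_abs_def mat_diag_def)
  have PD: "mat_abs P * mat_abs (mat_diag n d) = mat n n (\<lambda>(i, j). mat_abs P $$ (i, j) * \<bar>d j\<bar>)"
    (is "_ = ?PD")
    unfolding D by (rule mat_diag_mult_right[OF Pc])
  have "(?PD * mat_abs Y) $$ (r, c) = (\<Sum>i<n. ?PD $$ (r, i) * mat_abs Y $$ (i, c))"
    by (rule index_mult_mat_sum[OF mat_carrier Yc rc])
  also have "\<dots> = (\<Sum>i<n. \<bar>P $$ (r, i)\<bar> * \<bar>d i\<bar> * \<bar>Y $$ (i, c)\<bar>)"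
  proof (rule sum.cong[OF refl])
    fix i assume "i \<in> {..<n}"
    then have i: "i < n" by simp
    show "?PD $$ (r, i) * mat_abs Y $$ (i, c) = \<bar>P $$ (r, i)\<bar> * \<bar>d i\<bar> * \<bar>Y $$ (i, c)\<bar>"
      by (simp add: i rc(1) index_mat_abs[OF P rc(1) i] index_mat_abs[OF Y i rc(2)])
  qed
  finally show ?thesis
    unfolding PD .
qed

lemma mult_if_delta_left: "(if b then x else 0) * y = (if b then x * y else (0 :: real))"
  by simp

lemma mult_if_delta_right: "y * (if b then x else 0) = (if b then y * x else (0 :: real))"
  by simp

text \<open>
  The derivatives with respect to row parameters are supported on one row, those with respect to
  column parameters on one column. For them the triple product \<open>V P X\<close> factors in each entry, which
  is why its absolute value splits into a product of absolute values of two matrices.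
\<close>

lemma index_mult_single_row:
  fixes V :: "real mat"
  assumes V: "V \<in> carrier_mat n n" and P: "P \<in> carrier_mat n n" and R: "R \<in> carrier_mat n n"
    and X: "X \<in> carrier_mat n m" and rc: "r < n" "c < m" and i: "i < n"
    and PR: "\<And>s t. s < n \<Longrightarrow> t < n \<Longrightarrow> P $$ (s, t) = (if s = i then R $$ (i, t) else 0)"
  shows "(V * P * X) $$ (r, c) = V $$ (r, i) * (R * X) $$ (i, c)"
proof -
  have PX: "(P * X) $$ (s, c) = (if s = i then (R * X) $$ (i, c) else 0)" if s: "s < n" for s
  proof -
    have "(P * X) $$ (s, c) = (\<Sum>l<n. P $$ (s, l) * X $$ (l, c))"
      by (rule index_mult_mat_sum[OF P X s rc(2)])
    also have "\<dots> = (\<Sum>l<n. (if s = i then R $$ (i, l) else 0) * X $$ (l, c))"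
      by (rule sum.cong, rule refl, subst PR, rule s, simp, rule refl)
    also have "\<dots> = (if s = i then \<Sum>l<n. R $$ (i, l) * X $$ (l, c) else 0)"
      by simp
    also have "(\<Sum>l<n. R $$ (i, l) * X $$ (l, c)) = (R * X) $$ (i, c)"
      by (rule index_mult_mat_sum[OF R X i rc(2), symmetric])
    finally show ?thesis .
  qed
  have "(V * P * X) $$ (r, c) = (V * (P * X)) $$ (r, c)"
    by (subst assoc_mult_mat[OF V P X]) (rule refl)
  also have "\<dots> = (\<Sum>s<n. V $$ (r, s) * (P * X) $$ (s, c))"
    by (rule index_mult_mat_sum[OF V mult_carrier_mat[OF P X] rc])
  also have "\<dots> = (\<Sum>s<n. if s = i then V $$ (r, s) * (R * X) $$ (i, c) else 0)"
    by (rule sum.cong, rule refl, subst PX, simp, subst mult_if_delta_right, rule refl)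
  also have "\<dots> = V $$ (r, i) * (R * X) $$ (i, c)"
    using i by (simp only: sum.delta finite_lessThan lessThan_iff if_True)
  finally show ?thesis .
qed

lemma index_mult_single_column:
  fixes V :: "real mat"
  assumes V: "V \<in> carrier_mat n n" and P: "P \<in> carrier_mat n n" and R: "R \<in> carrier_mat n n"
    and X: "X \<in> carrier_mat n m" and rc: "r < n" "c < m" and j: "j < n"
    and PR: "\<And>s t. s < n \<Longrightarrow> t < n \<Longrightarrow> P $$ (s, t) = (if t = j then R $$ (s, j) else 0)"
  shows "(V * P * X) $$ (r, c) = (V * R) $$ (r, j) * X $$ (j, c)"
proof -
  have VP: "(V * P) $$ (r, t) = (if t = j then (V * R) $$ (r, j) else 0)" if t: "t < n" for t
  proof -
    have "(V * P) $$ (r, t) = (\<Sum>l<n. V $$ (r, l) * P $$ (l, t))"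
      by (rule index_mult_mat_sum[OF V P rc(1) t])
    also have "\<dots> = (\<Sum>l<n. V $$ (r, l) * (if t = j then R $$ (l, j) else 0))"
      by (rule sum.cong, rule refl, subst PR, simp, rule t, rule refl)
    also have "\<dots> = (if t = j then \<Sum>l<n. V $$ (r, l) * R $$ (l, j) else 0)"
      by simp
    also have "(\<Sum>l<n. V $$ (r, l) * R $$ (l, j)) = (V * R) $$ (r, j)"
      by (rule index_mult_mat_sum[OF V R rc(1) j, symmetric])
    finally show ?thesis .
  qed
  have "(V * P * X) $$ (r, c) = (\<Sum>t<n. (V * P) $$ (r, t) * X $$ (t, c))"
    by (rule index_mult_mat_sum[OF mult_carrier_mat[OF V P] X rc])
  also have "\<dots> = (\<Sum>t<n. if t = j then (V * R) $$ (r, j) * X $$ (t, c) else 0)"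
    by (rule sum.cong, rule refl, subst VP, simp, subst mult_if_delta_left, rule refl)
  also have "\<dots> = (V * R) $$ (r, j) * X $$ (j, c)"
    using j by (simp only: sum.delta finite_lessThan lessThan_iff if_True)
  finally show ?thesis .
qed

text \<open>
  The matrix \<open>\<Omega> \<zeta> D\<^sub>\<zeta>\<close>, described without derivatives as a part of the quasiseparable matrix.
\<close>

definition qs_part :: "nat \<Rightarrow> (qs_param \<Rightarrow> real) \<Rightarrow> qs_param \<Rightarrow> real mat" where
  "qs_part n \<Omega> \<zeta> = mat n n (\<lambda>(r, c). if \<zeta> \<in> qs_factors r c then qs_mat n \<Omega> $$ (r, c) else 0)"

lemma qs_part_carrier [simp]: "qs_part n \<Omega> \<zeta> \<in> carrier_mat n n"
  by (simp add: qs_part_def)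

lemma qs_part_eq_smult_deriv: "qs_part n \<Omega> \<zeta> = \<Omega> \<zeta> \<cdot>\<^sub>m qs_deriv n \<Omega> \<zeta>"
proof (rule eq_matI)
  fix r c assume "r < dim_row (\<Omega> \<zeta> \<cdot>\<^sub>m qs_deriv n \<Omega> \<zeta>)" "c < dim_col (\<Omega> \<zeta> \<cdot>\<^sub>m qs_deriv n \<Omega> \<zeta>)"
  then have rc: "r < n" "c < n" by (auto simp: qs_deriv_def)
  show "qs_part n \<Omega> \<zeta> $$ (r, c) = (\<Omega> \<zeta> \<cdot>\<^sub>m qs_deriv n \<Omega> \<zeta>) $$ (r, c)"
    using rc prod.remove[OF finite_qs_factors, of \<zeta> r c \<Omega>]
    by (simp add: qs_part_def qs_deriv_def index_qs_mat[OF rc])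
qed (auto simp: qs_part_def qs_deriv_def)

text \<open>
  The entries are linear in \<open>D\<^sub>\<zeta>\<close>, which settles the case \<open>\<Omega> \<zeta> \<noteq> 0\<close>. For \<open>\<Omega> \<zeta> = 0\<close>
  both sides vanish, the left one because of the assumption on the weight.
\<close>

lemma weight_deriv_eq_quotient_part:
  assumes V: "V \<in> carrier_mat n n" and X: "X \<in> carrier_mat n m" and rc: "r < n" "c < m"
    and E: "0 \<le> E \<zeta>" "\<Omega> \<zeta> = 0 \<Longrightarrow> E \<zeta> = 0"
  shows "E \<zeta> * \<bar>(V * qs_deriv n \<Omega> \<zeta> * X) $$ (r, c)\<bar>
    = \<bar>E \<zeta> / \<Omega> \<zeta>\<bar> * \<bar>(V * qs_part n \<Omega> \<zeta> * X) $$ (r, c)\<bar>"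
proof -
  have "V * qs_part n \<Omega> \<zeta> * X = \<Omega> \<zeta> \<cdot>\<^sub>m (V * qs_deriv n \<Omega> \<zeta> * X)"
    unfolding qs_part_eq_smult_deriv
    by (simp only: mult_smult_distrib[OF V qs_deriv_carrier]
        mult_smult_assoc_mat[OF mult_carrier_mat[OF V qs_deriv_carrier] X])
  then have "(V * qs_part n \<Omega> \<zeta> * X) $$ (r, c) = \<Omega> \<zeta> * (V * qs_deriv n \<Omega> \<zeta> * X) $$ (r, c)"
    using V X rc by (simp del: index_mult_mat(1))
  then show ?thesis
    using E by (cases "\<Omega> \<zeta> = 0") (auto simp: abs_mult abs_divide simp del: index_mult_mat(1))
qed

lemma sum_qs_index:
  "(\<Sum>\<zeta>\<in>qs_index n. g \<zeta>) =
     (\<Sum>i\<in>{2..n}. g (Par_p i)) + (\<Sum>i\<in>{2..n-1}. g (Par_a i)) + (\<Sum>i\<in>{1..n-1}. g (Par_q i))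
     + (\<Sum>i\<in>{1..n}. g (Par_d i)) + (\<Sum>i\<in>{1..n-1}. g (Par_g i)) + (\<Sum>i\<in>{2..n-1}. g (Par_b i))
     + (\<Sum>i\<in>{2..n}. g (Par_h i))" for g :: "qs_param \<Rightarrow> real"
proof -
  have "sum g (K ` I) = (\<Sum>i\<in>I. g (K i))" if "inj K" for K and I :: "nat set"
    using that by (subst sum.reindex) (auto simp: inj_def inj_on_def)
  moreover have "inj Par_p" "inj Par_a" "inj Par_q" "inj Par_d" "inj Par_g" "inj Par_b" "inj Par_h"
    by (auto simp: inj_def)
  moreover have "sum g (qs_index n) = sum g (Par_p ` {2..n}) + sum g (Par_a ` {2..n-1})
      + sum g (Par_q ` {1..n-1}) + sum g (Par_d ` {1..n}) + sum g (Par_g ` {1..n-1})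
      + sum g (Par_b ` {2..n-1}) + sum g (Par_h ` {2..n})"
    unfolding qs_index_def
    by (subst sum.union_disjoint, simp, simp, force)+ (rule refl)
  ultimately show ?thesis by simp
qed

lemma sum_shift_from_1: "(\<Sum>i\<in>{1..n}. g (i - 1)) = (\<Sum>i<n. g i)" for g :: "nat \<Rightarrow> real"
  by (rule sum.reindex_bij_witness[of _ Suc "\<lambda>i. i - 1"]) auto

lemma strict_parts_carrier:
  assumes "A \<in> carrier_mat n n"
  shows "strict_lower_part A \<in> carrier_mat n n" "strict_upper_part A \<in> carrier_mat n n"
  using assms by (auto simp: strict_lower_part_def strict_upper_part_def)

lemma index_strict_parts:
  assumes "A \<in> carrier_mat n n" "s < n" "t < n"
  shows "strict_lower_part A $$ (s, t) = (if t < s then A $$ (s, t) else 0)"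
    "strict_upper_part A $$ (s, t) = (if s < t then A $$ (s, t) else 0)"
  using assms by (auto simp: strict_lower_part_def strict_upper_part_def)

text \<open>
  The sum over all parameters is now evaluated family by family, in a fixed entry of the
  sensitivity matrix.
\<close>

context
  fixes n m :: nat and \<Omega> E :: "qs_param \<Rightarrow> real" and V X A :: "real mat" and r c :: nat
  assumes V: "V \<in> carrier_mat n n" and X: "X \<in> carrier_mat n m" and rc: "r < n" "c < m"
    and E: "\<forall>\<zeta>\<in>qs_index n. 0 \<le> E \<zeta>" and adm: "weights_admissible n \<Omega> E"
    and A: "A = qs_mat n \<Omega>"
begin

lemma A_carrier: "A \<in> carrier_mat n n"
  by (simp add: A)

lemma index_qs_part:
  assumes "s < n" "t < n"
  shows "qs_part n \<Omega> \<zeta> $$ (s, t) = (if \<zeta> \<in> qs_factors s t then A $$ (s, t) else 0)"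
  using assms by (simp add: qs_part_def A)

lemma weight_deriv:
  assumes "\<zeta> \<in> qs_index n" "\<zeta> \<notin> range Par_d"
  shows "E \<zeta> * \<bar>(V * qs_deriv n \<Omega> \<zeta> * X) $$ (r, c)\<bar>
    = \<bar>E \<zeta> / \<Omega> \<zeta>\<bar> * \<bar>(V * qs_part n \<Omega> \<zeta> * X) $$ (r, c)\<bar>"
  using assms E adm
  by (intro weight_deriv_eq_quotient_part[OF V X rc]) (auto simp: weights_admissible_def)

text \<open>
  For \<open>R\<close> the strictly lower or upper part of \<open>A\<close> this covers the parameters \<open>p\<^sub>i\<close> and \<open>g\<^sub>i\<close>. One
  index is without parameter, and there \<open>d\<close> is arbitrary: the corresponding row of \<open>R\<close> is zero. This
  is why the entry 1 in the diagonal matrices of quotients is harmless.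
\<close>

lemma sum_row_family:
  assumes I: "I \<subseteq> {1..n}" and K: "K ` I \<subseteq> qs_index n - range Par_d"
    and R: "R \<in> carrier_mat n n"
    and row: "\<And>i s t. i \<in> I \<Longrightarrow> s < n \<Longrightarrow> t < n \<Longrightarrow>
      qs_part n \<Omega> (K i) $$ (s, t) = (if s = i - 1 then R $$ (i - 1, t) else 0)"
    and zero: "\<And>i t. i \<in> {1..n} - I \<Longrightarrow> t < n \<Longrightarrow> R $$ (i - 1, t) = 0"
    and d: "\<And>i. i \<in> I \<Longrightarrow> d (i - 1) = E (K i) / \<Omega> (K i)"
  shows "(\<Sum>i\<in>I. E (K i) * \<bar>(V * qs_deriv n \<Omega> (K i) * X) $$ (r, c)\<bar>)
    = (mat_abs V * mat_abs (mat_diag n d) * mat_abs (R * X)) $$ (r, c)"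
proof -
  define g where "g i = \<bar>V $$ (r, i)\<bar> * \<bar>d i\<bar> * \<bar>(R * X) $$ (i, c)\<bar>" for i
  have "E (K i) * \<bar>(V * qs_deriv n \<Omega> (K i) * X) $$ (r, c)\<bar> = g (i - 1)" if i: "i \<in> I" for i
  proof -
    have "i - 1 < n" using i I by fastforce
    then have "(V * qs_part n \<Omega> (K i) * X) $$ (r, c) = V $$ (r, i - 1) * (R * X) $$ (i - 1, c)"
      by (intro index_mult_single_row[OF V qs_part_carrier R X rc]) (simp_all add: row[OF i])
    moreover have "K i \<in> qs_index n" "K i \<notin> range Par_d" using i K by auto
    ultimately show ?thesis
      by (simp only: weight_deriv g_def d[OF i] abs_mult mult_ac simp_thms if_True)
  qed
  then have "(\<Sum>i\<in>I. E (K i) * \<bar>(V * qs_deriv n \<Omega> (K i) * X) $$ (r, c)\<bar>) = (\<Sum>i\<in>I. g (i - 1))"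
    by (intro sum.cong) auto
  also have "\<dots> = (\<Sum>i\<in>{1..n}. g (i - 1))"
  proof (intro sum.mono_neutral_left I ballI)
    fix i assume i: "i \<in> {1..n} - I"
    then have "i - 1 < n" by auto
    then have "(R * X) $$ (i - 1, c) = 0"
      using rc(2) zero[OF i] by (simp add: index_mult_mat_sum[OF R X])
    then show "g (i - 1) = 0" by (simp add: g_def del: index_mult_mat(1))
  qed simp
  also have "\<dots> = (\<Sum>i<n. g i)" by (rule sum_shift_from_1)
  also have "\<dots> = (mat_abs V * mat_abs (mat_diag n d) * mat_abs (R * X)) $$ (r, c)"
    unfolding index_mult_abs_diag[OF V mult_carrier_mat[OF R X] rc] g_def ..
  finally show ?thesis .
qed

text \<open>
  The counterpart for columns, used for \<open>q\<^sub>j\<close> and \<open>h\<^sub>j\<close>; the column of \<open>R\<close> at the index without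
  parameter is zero.
\<close>

lemma sum_column_family:
  assumes I: "I \<subseteq> {1..n}" and K: "K ` I \<subseteq> qs_index n - range Par_d"
    and R: "R \<in> carrier_mat n n"
    and column: "\<And>j s t. j \<in> I \<Longrightarrow> s < n \<Longrightarrow> t < n \<Longrightarrow>
      qs_part n \<Omega> (K j) $$ (s, t) = (if t = j - 1 then R $$ (s, j - 1) else 0)"
    and zero: "\<And>j s. j \<in> {1..n} - I \<Longrightarrow> s < n \<Longrightarrow> R $$ (s, j - 1) = 0"
    and d: "\<And>j. j \<in> I \<Longrightarrow> d (j - 1) = E (K j) / \<Omega> (K j)"
  shows "(\<Sum>j\<in>I. E (K j) * \<bar>(V * qs_deriv n \<Omega> (K j) * X) $$ (r, c)\<bar>)
    = (mat_abs (V * R) * mat_abs (mat_diag n d) * mat_abs X) $$ (r, c)"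
proof -
  define g where "g j = \<bar>(V * R) $$ (r, j)\<bar> * \<bar>d j\<bar> * \<bar>X $$ (j, c)\<bar>" for j
  have "E (K j) * \<bar>(V * qs_deriv n \<Omega> (K j) * X) $$ (r, c)\<bar> = g (j - 1)" if j: "j \<in> I" for j
  proof -
    have "j - 1 < n" using j I by fastforce
    then have "(V * qs_part n \<Omega> (K j) * X) $$ (r, c) = (V * R) $$ (r, j - 1) * X $$ (j - 1, c)"
      by (intro index_mult_single_column[OF V qs_part_carrier R X rc]) (simp_all add: column[OF j])
    moreover have "K j \<in> qs_index n" "K j \<notin> range Par_d" using j K by auto
    ultimately show ?thesis
      by (simp only: weight_deriv g_def d[OF j] abs_mult mult_ac simp_thms if_True)
  qed
  then have "(\<Sum>j\<in>I. E (K j) * \<bar>(V * qs_deriv n \<Omega> (K j) * X) $$ (r, c)\<bar>) = (\<Sum>j\<in>I. g (j - 1))"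
    by (intro sum.cong) auto
  also have "\<dots> = (\<Sum>j\<in>{1..n}. g (j - 1))"
  proof (intro sum.mono_neutral_left I ballI)
    fix j assume j: "j \<in> {1..n} - I"
    then have "j - 1 < n" by auto
    then have "(V * R) $$ (r, j - 1) = 0"
      using rc(1) zero[OF j] by (simp add: index_mult_mat_sum[OF V R])
    then show "g (j - 1) = 0" by (simp add: g_def del: index_mult_mat(1))
  qed simp
  also have "\<dots> = (\<Sum>j<n. g j)" by (rule sum_shift_from_1)
  also have "\<dots> = (mat_abs (V * R) * mat_abs (mat_diag n d) * mat_abs X) $$ (r, c)"
    unfolding index_mult_abs_diag[OF mult_carrier_mat[OF V R] X rc] g_def ..
  finally show ?thesis .
qed

lemma p_contribution:
  "(\<Sum>i\<in>{2..n}. E (Par_p i) * \<bar>(V * qs_deriv n \<Omega> (Par_p i) * X) $$ (r, c)\<bar>)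
    = (mat_abs V * mat_abs (D_p n \<Omega> E) * mat_abs (strict_lower_part A * X)) $$ (r, c)"
  unfolding D_p_def
  by (rule sum_row_family)
    (auto simp: qs_index_def index_qs_part index_strict_parts[OF A_carrier] strict_parts_carrier[OF A_carrier] qs_factors_def)

lemma g_contribution:
  "(\<Sum>i\<in>{1..n-1}. E (Par_g i) * \<bar>(V * qs_deriv n \<Omega> (Par_g i) * X) $$ (r, c)\<bar>)
    = (mat_abs V * mat_abs (D_g n \<Omega> E) * mat_abs (strict_upper_part A * X)) $$ (r, c)"
  unfolding D_g_def
  by (rule sum_row_family)
    (auto simp: qs_index_def index_qs_part index_strict_parts[OF A_carrier] strict_parts_carrier[OF A_carrier] qs_factors_def)

lemma q_contribution:
  "(\<Sum>j\<in>{1..n-1}. E (Par_q j) * \<bar>(V * qs_deriv n \<Omega> (Par_q j) * X) $$ (r, c)\<bar>)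
    = (mat_abs (V * strict_lower_part A) * mat_abs (D_q n \<Omega> E) * mat_abs X) $$ (r, c)"
  unfolding D_q_def
  by (rule sum_column_family)
    (auto simp: qs_index_def index_qs_part index_strict_parts[OF A_carrier] strict_parts_carrier[OF A_carrier] qs_factors_def)

lemma h_contribution:
  "(\<Sum>j\<in>{2..n}. E (Par_h j) * \<bar>(V * qs_deriv n \<Omega> (Par_h j) * X) $$ (r, c)\<bar>)
    = (mat_abs (V * strict_upper_part A) * mat_abs (D_h n \<Omega> E) * mat_abs X) $$ (r, c)"
  unfolding D_h_def
  by (rule sum_column_family)
    (auto simp: qs_index_def index_qs_part index_strict_parts[OF A_carrier] strict_parts_carrier[OF A_carrier] qs_factors_def)

lemma d_contribution:
  "(\<Sum>i\<in>{1..n}. E (Par_d i) * \<bar>(V * qs_deriv n \<Omega> (Par_d i) * X) $$ (r, c)\<bar>)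
    = (mat_abs V * mat_abs (D_d n E) * mat_abs X) $$ (r, c)"
proof -
  define g where "g i = \<bar>V $$ (r, i)\<bar> * \<bar>E (Par_d (i + 1))\<bar> * \<bar>X $$ (i, c)\<bar>" for i
  have "E (Par_d i) * \<bar>(V * qs_deriv n \<Omega> (Par_d i) * X) $$ (r, c)\<bar> = g (i - 1)"
    if i: "i \<in> {1..n}" for i
  proof -
    \<comment> \<open>The derivative is the \<open>i\<close>-th diagonal matrix unit, that is, one row of the unit matrix.\<close>
    have "(V * qs_deriv n \<Omega> (Par_d i) * X) $$ (r, c) = V $$ (r, i - 1) * (1\<^sub>m n * X) $$ (i - 1, c)"
      using i by (intro index_mult_single_row[OF V qs_deriv_carrier one_carrier_mat X rc])
        (auto simp: qs_deriv_def qs_factors_def)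
    also have "1\<^sub>m n * X = X" using X by simp
    finally show ?thesis
      using i E by (auto simp: g_def abs_mult qs_index_def simp del: index_mult_mat(1))
  qed
  then have "(\<Sum>i\<in>{1..n}. E (Par_d i) * \<bar>(V * qs_deriv n \<Omega> (Par_d i) * X) $$ (r, c)\<bar>)
      = (\<Sum>i\<in>{1..n}. g (i - 1))" by (intro sum.cong) auto
  also have "\<dots> = (\<Sum>i<n. g i)" by (rule sum_shift_from_1)
  also have "\<dots> = (mat_abs V * mat_abs (D_d n E) * mat_abs X) $$ (r, c)"
    unfolding D_d_def index_mult_abs_diag[OF V X rc] g_def ..
  finally show ?thesis .
qed

lemma a_contribution:
  "(\<Sum>i\<in>{2..n-1}. E (Par_a i) * \<bar>(V * qs_deriv n \<Omega> (Par_a i) * X) $$ (r, c)\<bar>)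
    = mat_sum n m (\<lambda>i. \<bar>E (Par_a i) / \<Omega> (Par_a i)\<bar> \<cdot>\<^sub>m
        mat_abs (V * lower_block n A i * X)) {2..n-1} $$ (r, c)"
proof -
  have B: "lower_block n A i \<in> carrier_mat n n" for i by (simp add: lower_block_def)
  \<comment> \<open>The parameter \<open>a\<^sub>i\<close> occurs in the entry \<open>(s, t)\<close>, in one-based indices, iff \<open>t < i < s\<close>.\<close>
  have "qs_part n \<Omega> (Par_a i) = lower_block n A i" for i
    by (rule eq_matI) (auto simp: qs_part_def lower_block_def qs_factors_def A)
  then have "E (Par_a i) * \<bar>(V * qs_deriv n \<Omega> (Par_a i) * X) $$ (r, c)\<bar>
      = \<bar>E (Par_a i) / \<Omega> (Par_a i)\<bar> * mat_abs (V * lower_block n A i * X) $$ (r, c)"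
    if "i \<in> {2..n-1}" for i
    using that by (subst weight_deriv)
      (auto simp: qs_index_def index_mat_abs[OF mult_carrier_mat[OF mult_carrier_mat[OF V B] X] rc])
  then show ?thesis
    using V B X by (subst index_mat_sum_smult[OF _ rc]) (auto intro!: sum.cong)
qed

lemma b_contribution:
  "(\<Sum>i\<in>{2..n-1}. E (Par_b i) * \<bar>(V * qs_deriv n \<Omega> (Par_b i) * X) $$ (r, c)\<bar>)
    = mat_sum n m (\<lambda>i. \<bar>E (Par_b i) / \<Omega> (Par_b i)\<bar> \<cdot>\<^sub>m
        mat_abs (V * upper_block n A i * X)) {2..n-1} $$ (r, c)"
proof -
  have B: "upper_block n A i \<in> carrier_mat n n" for i by (simp add: upper_block_def)
  have "qs_part n \<Omega> (Par_b i) = upper_block n A i" for i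
    by (rule eq_matI) (auto simp: qs_part_def upper_block_def qs_factors_def A)
  then have "E (Par_b i) * \<bar>(V * qs_deriv n \<Omega> (Par_b i) * X) $$ (r, c)\<bar>
      = \<bar>E (Par_b i) / \<Omega> (Par_b i)\<bar> * mat_abs (V * upper_block n A i * X) $$ (r, c)"
    if "i \<in> {2..n-1}" for i
    using that by (subst weight_deriv)
      (auto simp: qs_index_def index_mat_abs[OF mult_carrier_mat[OF mult_carrier_mat[OF V B] X] rc])
  then show ?thesis
    using V B X by (subst index_mat_sum_smult[OF _ rc]) (auto intro!: sum.cong)
qed

end

section \<open>The condition number\<close>

lemma mat_inv:
  assumes A: "A \<in> carrier_mat n n" and inv: "invertible_mat A"
  shows "mat_inv A \<in> carrier_mat n n" "mat_inv A * A = 1\<^sub>m n"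
proof -
  obtain B where B: "A * B = 1\<^sub>m n" "B * A = 1\<^sub>m (dim_row B)"
    using inv A by (auto simp: invertible_mat_def inverts_mat_def)
  have "dim_col B = n" using arg_cong[OF B(1), of dim_col] by simp
  moreover have "dim_row B = n" using arg_cong[OF B(2), of dim_col] A by simp
  ultimately have "A \<in> Units (ring_mat TYPE(real) n ())"
    using A B by (auto simp: Units_def ring_mat_def intro!: bexI[of _ B])
  then obtain C where "mat_inverse A = Some C"
    using mat_inverse(1)[OF A, where b = "()"] by (cases "mat_inverse A") auto
  then show "mat_inv A \<in> carrier_mat n n" "mat_inv A * A = 1\<^sub>m n"
    using mat_inverse(2)[OF A] by (auto simp: mat_inv_def)
qed

theorem theorem4p1:
  fixes n m M :: nat
    and A B X :: "real mat"
    and S :: "nat \<Rightarrow> real mat"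
    and \<Omega> E :: "qs_param \<Rightarrow> real"
    and \<omega> f :: "nat \<Rightarrow> real"
  assumes "n \<ge> 2" and "m \<ge> 1"
    and "A = qs_mat n \<Omega>" and "invertible_mat A"
    and "\<forall>k\<in>{1..M}. S k \<in> carrier_mat n m"
    and "B = sparse_mat n m M S \<omega>"
    and "X \<in> carrier_mat n m" and "A * X = B"
    and "\<forall>i<n. \<forall>j<m. X $$ (i, j) \<noteq> 0"
    and "\<forall>k\<in>{1..M}. 0 \<le> f k"
    and "\<forall>\<zeta>\<in>qs_index n. 0 \<le> E \<zeta>"
    and "weights_admissible n \<Omega> E"
  defines "A\<^sub>L \<equiv> strict_lower_part A"
    and "A\<^sub>U \<equiv> strict_upper_part A"
  defines "K \<equiv> 1 / max_norm X * max_norm (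
      mat_sum n m (\<lambda>k. f k \<cdot>\<^sub>m mat_abs (mat_inv A * S k)) {1..M}
    + mat_abs (mat_inv A) * mat_abs (D_d n E) * mat_abs X
    + mat_abs (mat_inv A) * mat_abs (D_p n \<Omega> E) * mat_abs (A\<^sub>L * X)
    + mat_abs (mat_inv A * A\<^sub>L) * mat_abs (D_q n \<Omega> E) * mat_abs X
    + mat_abs (mat_inv A) * mat_abs (D_g n \<Omega> E) * mat_abs (A\<^sub>U * X)
    + mat_abs (mat_inv A * A\<^sub>U) * mat_abs (D_h n \<Omega> E) * mat_abs X
    + mat_sum n m (\<lambda>i. \<bar>E (Par_a i) / \<Omega> (Par_a i)\<bar> \<cdot>\<^sub>m
        mat_abs (mat_inv A * lower_block n A i * X)) {2..n-1}
    + mat_sum n m (\<lambda>i. \<bar>E (Par_b i) / \<Omega> (Par_b i)\<bar> \<cdot>\<^sub>m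
        mat_abs (mat_inv A * upper_block n A i * X)) {2..n-1})"
  shows "(qs_relative_change n m M S \<Omega> \<omega> E f X \<longlongrightarrow> qs_cond n m M S \<Omega> \<omega> E f X) (at_right 0)
    \<and> qs_cond n m M S \<Omega> \<omega> E f X = ereal K"
proof -
  have n: "0 < n" and m: "0 < m" using assms(1,2) by auto
  note \<Omega> = assms(3) and S = assms(5) and X = assms(7) and f = assms(10) and E = assms(11)
    and adm = assms(12)
  define V where "V = mat_inv A"
  have Ac: "A \<in> carrier_mat n n" by (simp add: \<Omega>)
  have V: "V \<in> carrier_mat n n" "V * A = 1\<^sub>m n"
    unfolding V_def by (rule mat_inv[OF Ac assms(4)])+
  have X0: "0 < max_norm X"
    using abs_le_max_norm[OF X n m] assms(9) n m by (smt (verit) zero_less_abs_iff)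
  note Ls = strict_parts_carrier[OF Ac, folded A\<^sub>L_def A\<^sub>U_def]
  have T: "mat_sum n m (\<lambda>k. f k \<cdot>\<^sub>m mat_abs (V * S k)) {1..M}
    + mat_abs V * mat_abs (D_d n E) * mat_abs X
    + mat_abs V * mat_abs (D_p n \<Omega> E) * mat_abs (A\<^sub>L * X)
    + mat_abs (V * A\<^sub>L) * mat_abs (D_q n \<Omega> E) * mat_abs X
    + mat_abs V * mat_abs (D_g n \<Omega> E) * mat_abs (A\<^sub>U * X)
    + mat_abs (V * A\<^sub>U) * mat_abs (D_h n \<Omega> E) * mat_abs X
    + mat_sum n m (\<lambda>i. \<bar>E (Par_a i) / \<Omega> (Par_a i)\<bar> \<cdot>\<^sub>m
        mat_abs (V * lower_block n A i * X)) {2..n-1}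
    + mat_sum n m (\<lambda>i. \<bar>E (Par_b i) / \<Omega> (Par_b i)\<bar> \<cdot>\<^sub>m
        mat_abs (V * upper_block n A i * X)) {2..n-1}
    = qs_sensitivity n m M S \<Omega> E f X V" (is "?Tf + ?Td + ?Tp + ?Tq + ?Tg + ?Th + ?Ta + ?Tb = _")
  proof (rule eq_matI)
    fix r c assume "r < dim_row (qs_sensitivity n m M S \<Omega> E f X V)"
      "c < dim_col (qs_sensitivity n m M S \<Omega> E f X V)"
    then have rc: "r < n" "c < m" by (auto simp: qs_sensitivity_def)
    have VS: "\<forall>k\<in>{1..M}. V * S k \<in> carrier_mat n m"
      using mult_carrier_mat[OF V(1)] S by blast
    then have "\<forall>k\<in>{1..M}. mat_abs (V * S k) \<in> carrier_mat n m"
      by (simp only: mat_abs_carrier)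
    then have "?Tf $$ (r, c) = (\<Sum>k\<in>{1..M}. f k * mat_abs (V * S k) $$ (r, c))"
      by (rule index_mat_sum_smult[OF _ rc])
    also have "\<dots> = (\<Sum>k\<in>{1..M}. f k * \<bar>(V * S k) $$ (r, c)\<bar>)"
      using VS by (intro sum.cong refl arg_cong2[where f = "(*)"] index_mat_abs[OF _ rc]) blast
    finally have Tf: "?Tf $$ (r, c) = (\<Sum>k\<in>{1..M}. f k * \<bar>(V * S k) $$ (r, c)\<bar>)" .
    note sums = d_contribution[OF V(1) X rc E adm \<Omega>] p_contribution[OF V(1) X rc E adm \<Omega>] q_contribution[OF V(1) X rc E adm \<Omega>]
      g_contribution[OF V(1) X rc E adm \<Omega>] h_contribution[OF V(1) X rc E adm \<Omega>]
      a_contribution[OF V(1) X rc E adm \<Omega>] b_contribution[OF V(1) X rc E adm \<Omega>]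
    have "(?Tf + ?Td + ?Tp + ?Tq + ?Tg + ?Th + ?Ta + ?Tb) $$ (r, c)
        = ?Tf $$ (r, c) + ?Td $$ (r, c) + ?Tp $$ (r, c) + ?Tq $$ (r, c) + ?Tg $$ (r, c)
          + ?Th $$ (r, c) + ?Ta $$ (r, c) + ?Tb $$ (r, c)"
      using rc V X Ls by (simp add: mat_sum_def mat_abs_def del: index_mult_mat(1))
    also have "\<dots> = qs_sensitivity n m M S \<Omega> E f X V $$ (r, c)"
      unfolding Tf A\<^sub>L_def A\<^sub>U_def sums[symmetric] using rc
      by (simp add: qs_sensitivity_def sum_qs_index del: index_mult_mat(1))
    finally show "(?Tf + ?Td + ?Tp + ?Tq + ?Tg + ?Th + ?Ta + ?Tb) $$ (r, c)
      = qs_sensitivity n m M S \<Omega> E f X V $$ (r, c)" .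
  qed (simp_all add: qs_sensitivity_def mat_sum_def)
  have "(qs_relative_change n m M S \<Omega> \<omega> E f X \<longlongrightarrow>
      ereal (1 / max_norm X * max_norm (qs_sensitivity n m M S \<Omega> E f X V))) (at_right 0)"
    using qs_relative_change_tendsto[OF n m S X X0 _ V(1) _ f E] assms(6,8) V(2) by (simp add: \<Omega>)
  then have "(qs_relative_change n m M S \<Omega> \<omega> E f X \<longlongrightarrow> ereal K) (at_right 0)"
    unfolding K_def V_def[symmetric] T .
  moreover from this have "qs_cond n m M S \<Omega> \<omega> E f X = ereal K"
    unfolding qs_cond_def by (intro tendsto_Lim) simp_all
  ultimately show ?thesis by simp
qed

end
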